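(* Let $M\subset\mathbb{R}^3$ be open, and let a wildfire spread in $M$ under the constant wind $W=(0,W_2,W_3)$, the propagation being governed by the Randers metric $F$ with Zermelo data $(h;W)$ described in the context, where $h=\tfrac12\operatorname{Hess}Q_h$ and $$Q_h(u,v,w)=\Big(\frac{u}{a}\Big)^2+\Big(\frac{v\cos\alpha-w\sin\alpha}{b}\Big)^2+\Big(\frac{v\sin\alpha+w\cos\alpha}{c}\Big)^2$$ with real constants $a,b,c>0$ and $\alpha$. Let $A$ be the wavefront at time $0$. Then: (i) For every $p\in M$, the spherical wavefront of radius $\tau$ and center $p$ is the translated ellipsoid $$\Big\{(u,v,w)\in\mathbb{R}^3 : Q_h\Big(\frac{u}{\tau},\frac{v}{\tau},\frac{w}{\tau}\Big)=1\Big\}+\tau W+p .$$ (ii) For every $p\in A$, the wave rays emanating from $p$ are the straight lines $\gamma_F(t)=p+tV$, where $V$ is a vector such that $|V-W|_h=1$ and $V-W$ is $h$-orthogonal to $A$ at $p$. (iii) The wavefront at time $\tau$ is the set $$\{p+\tau V : p\in A,\ |V-W|_h=1,\ V-W \text{ is } h\text{-orthogonal to } A \text{ at } p\}.$$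
   Context: Zermelo data: for a Riemannian metric $h$ and a vector field $W$ with $h(W,W)<1$, the Randers metric with Zermelo data $(h;W)$ is $F(V)=\frac{\sqrt{h(W,V)^2+\lambda h(V,V)}-h(W,V)}{\lambda}$, $\lambda=1-h(W,W)$; equivalently $F$ is positively homogeneous and $F(V)=1$ iff $h(V-W,V-W)=1$. Write $|V|_h=\sqrt{h(V,V)}$. Here $h$ and $W$ are constant (independent of the point) and $h(W,W)<1$. Distance: the length of a piecewise smooth curve $\gamma:[0,1]\to M$ is $\int_0^1F(\gamma'(t))\,dt$; $d(p,q)$ is the infimum of lengths of such curves from $p$ to $q$ (not symmetric in general); $d(A,q)=\inf_{p\in A}d(p,q)$ and $\rho(q)=d(A,q)$. An $F$-geodesic is a smooth curve that is locally the shortest-time path between nearby points on it; unit speed means $F(\gamma')=1$. Fire model: the fire starts at time $0$ from $A$, a compact smooth submanifold of $M$ (possibly a point). The wavefront at time $\tau$ is the set of points first reached at time $\tau$, i.e. $\rho^{-1}(\tau)$. The spherical wavefront of radius (time) $\tau$ and center $p$ is the wavefront at time $\tau$ when $A$ is replaced by $\{p\}$. A wave ray from $A$ is a unit-speed shortest-time path from $A$, i.e. $\gamma(0)\in A$ and $d(A,\gamma(t))=t$ for the times considered. Standing assumption (the fire is stopped before cut loci or singularities appear): all times $t,\tau$ lie in $(0,r]$, where $r$ is such that every unit-speed $F$-geodesic leaving $A$ $F$-orthogonally is defined in $M$ on $[0,r]$ and satisfies $d(A,\gamma(t))=t$ there, and every $q$ with $0<\rho(q)\le r$ is reached by such a geodesic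 at time $\rho(q)$. For spherical wavefronts the same is assumed with $A$ replaced by $\{p\}$ (all directions being allowed). A nonzero vector $V$ is $F$-orthogonal to $A$ if $g_V(V,U)=0$ for all $U$ tangent to $A$, where $g_V(V,U)=\frac12\frac{\partial^2}{\partial t\partial s}F^2(V+tV+sU)|_{s=t=0}$. A vector $X$ at $p\in A$ is $h$-orthogonal to $A$ if $h(X,U)=0$ for all $U\in T_pA$ (an empty condition if $A$ is a point). *)

theory Defs
  imports "HOL-Analysis.Analysis"
begin

section \<open>Smooth maps, curves and submanifolds\<close>

text \<open>Only meaningful for open \<open>S\<close>: derivatives are taken in the full space.\<close>

primrec C_on :: "nat \<Rightarrow> ('a::real_normed_vector \<Rightarrow> 'b::real_normed_vector) \<Rightarrow> 'a set \<Rightarrow> bool" where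
  "C_on 0 f S \<longleftrightarrow> continuous_on S f"
| "C_on (Suc n) f S \<longleftrightarrow>
     (\<forall>x\<in>S. f differentiable (at x)) \<and> (\<forall>v. C_on n (\<lambda>x. frechet_derivative f (at x) v) S)"

definition smooth_map_on :: "('a::real_normed_vector \<Rightarrow> 'b::real_normed_vector) \<Rightarrow> 'a set \<Rightarrow> bool" where
  "smooth_map_on f S \<longleftrightarrow> (\<forall>n. C_on n f S)"

text \<open>Smoothness on a closed interval means having a smooth extension to an open neighbourhood;
  it does not depend on the values of \<open>\<gamma>\<close> outside \<open>{a..b}\<close>.\<close>

definition smooth_curve :: "real \<Rightarrow> real \<Rightarrow> (real \<Rightarrow> 'a::real_normed_vector) \<Rightarrow> bool" where
  "smooth_curve a b \<gamma> \<longleftrightarrow>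
     (\<exists>J \<delta>. open J \<and> {a..b} \<subseteq> J \<and> smooth_map_on \<delta> J \<and> (\<forall>t\<in>{a..b}. \<delta> t = \<gamma> t))"

text \<open>The finite set \<open>T\<close> contains the break points.\<close>

definition piecewise_smooth_curve :: "real \<Rightarrow> real \<Rightarrow> (real \<Rightarrow> 'a::real_normed_vector) \<Rightarrow> bool" where
  "piecewise_smooth_curve a b \<gamma> \<longleftrightarrow> continuous_on {a..b} \<gamma> \<and>
     (\<exists>T. finite T \<and>
        (\<forall>s t. a \<le> s \<and> s < t \<and> t \<le> b \<and> {s<..<t} \<inter> T = {} \<longrightarrow> smooth_curve s t \<gamma>))"

text \<open>Embedded \<open>k\<close>-dimensional submanifolds (without boundary) of a Euclidean space, through
  adapted (slice) charts.\<close>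

definition smooth_submanifold :: "nat \<Rightarrow> 'a::euclidean_space set \<Rightarrow> bool" where
  "smooth_submanifold k A \<longleftrightarrow>
     (\<forall>p\<in>A. \<exists>(U::'a set) (U'::'a set) \<phi> \<psi> S. open U \<and> p \<in> U \<and> open U' \<and>
        homeomorphism U U' \<phi> \<psi> \<and> smooth_map_on \<phi> U \<and> smooth_map_on \<psi> U' \<and>
        subspace S \<and> dim S = k \<and> \<phi> ` (A \<inter> U) = U' \<inter> S)"

definition tangent_space_at :: "'a::euclidean_space set \<Rightarrow> 'a \<Rightarrow> 'a set" where
  "tangent_space_at A p =
     {v. \<exists>\<epsilon>>0. \<exists>c. smooth_map_on c {-\<epsilon><..<\<epsilon>} \<and> c ` {-\<epsilon><..<\<epsilon>} \<subseteq> A \<and> c 0 = p \<and>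
           (c has_vector_derivative v) (at 0)}"


section \<open>Hessians, Zermelo data and orthogonality\<close>

definition hessian :: "('a::real_vector \<Rightarrow> real) \<Rightarrow> 'a \<Rightarrow> 'a \<Rightarrow> 'a \<Rightarrow> real" where
  "hessian f x X Y = deriv (\<lambda>t. deriv (\<lambda>s. f (x + t *\<^sub>R X + s *\<^sub>R Y)) 0) 0"

definition zermelo_randers :: "('a \<Rightarrow> 'a \<Rightarrow> real) \<Rightarrow> 'a \<Rightarrow> 'a::real_vector \<Rightarrow> real" where
  "zermelo_randers h W V =
     (let l = 1 - h W W in (sqrt ((h W V)\<^sup>2 + l * h V V) - h W V) / l)"

definition metric_norm :: "('a \<Rightarrow> 'a \<Rightarrow> real) \<Rightarrow> 'a \<Rightarrow> real" where
  "metric_norm h V = sqrt (h V V)"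

definition h_orthogonal :: "('a \<Rightarrow> 'a \<Rightarrow> real) \<Rightarrow> 'a::euclidean_space set \<Rightarrow> 'a \<Rightarrow> 'a \<Rightarrow> bool" where
  "h_orthogonal h A p X \<longleftrightarrow> (\<forall>U\<in>tangent_space_at A p. h X U = 0)"

definition fundamental_tensor :: "('a::real_vector \<Rightarrow> real) \<Rightarrow> 'a \<Rightarrow> 'a \<Rightarrow> 'a \<Rightarrow> real" where
  "fundamental_tensor F V X Y = hessian (\<lambda>Z. (F Z)\<^sup>2) V X Y / 2"

definition F_orthogonal :: "('a \<Rightarrow> real) \<Rightarrow> 'a::euclidean_space set \<Rightarrow> 'a \<Rightarrow> 'a \<Rightarrow> bool" where
  "F_orthogonal F A p V \<longleftrightarrow>
     V \<noteq> 0 \<and> (\<forall>U\<in>tangent_space_at A p. fundamental_tensor F V V U = 0)"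


section \<open>Length, distance and geodesics of a position-independent metric on a domain \<open>M\<close>\<close>

text \<open>At the finitely many break points of a piecewise smooth curve the integrand may be
  arbitrary; this does not affect the integral.\<close>

definition curve_length :: "('a \<Rightarrow> real) \<Rightarrow> real \<Rightarrow> real \<Rightarrow> (real \<Rightarrow> 'a::real_normed_vector) \<Rightarrow> real" where
  "curve_length F a b \<gamma> = integral {a..b} (\<lambda>t. F (vector_derivative \<gamma> (at t within {a..b})))"

definition curves_between :: "'a::real_normed_vector set \<Rightarrow> 'a \<Rightarrow> 'a \<Rightarrow> (real \<Rightarrow> 'a) set" where
  "curves_between M p q =
     {\<gamma>. piecewise_smooth_curve 0 1 \<gamma> \<and> \<gamma> ` {0..1} \<subseteq> M \<and> \<gamma> 0 = p \<and> \<gamma> 1 = q}"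

text \<open>Extended-real valued, as \<open>M\<close> need not be connected: the infimum of the empty set is
  \<open>\<infinity>\<close>.\<close>

definition F_dist :: "('a \<Rightarrow> real) \<Rightarrow> 'a::real_normed_vector set \<Rightarrow> 'a \<Rightarrow> 'a \<Rightarrow> ereal" where
  "F_dist F M p q = (INF \<gamma>\<in>curves_between M p q. ereal (curve_length F 0 1 \<gamma>))"

definition F_setdist :: "('a \<Rightarrow> real) \<Rightarrow> 'a::real_normed_vector set \<Rightarrow> 'a set \<Rightarrow> 'a \<Rightarrow> ereal" where
  "F_setdist F M A q = (INF p\<in>A. F_dist F M p q)"

text \<open>\<open>F (\<gamma>') = 1\<close> wherever the velocity exists (one-sided at \<open>0\<close> and \<open>l\<close>).\<close>

definition unit_speed :: "('a \<Rightarrow> real) \<Rightarrow> real \<Rightarrow> (real \<Rightarrow> 'a::real_normed_vector) \<Rightarrow> bool" where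
  "unit_speed F l \<gamma> \<longleftrightarrow>
     (\<forall>t\<in>{0..l}. \<forall>v. (\<gamma> has_vector_derivative v) (at t within {0..l}) \<longrightarrow> F v = 1)"

definition F_geodesic :: "('a \<Rightarrow> real) \<Rightarrow> 'a::real_normed_vector set \<Rightarrow> real \<Rightarrow> (real \<Rightarrow> 'a) \<Rightarrow> bool" where
  "F_geodesic F M l \<gamma> \<longleftrightarrow> smooth_curve 0 l \<gamma> \<and> \<gamma> ` {0..l} \<subseteq> M \<and>
     (\<forall>t\<in>{0..l}. \<exists>\<epsilon>>0. \<forall>s1\<in>{0..l}. \<forall>s2\<in>{0..l}.
        \<bar>s1 - t\<bar> < \<epsilon> \<and> \<bar>s2 - t\<bar> < \<epsilon> \<and> s1 < s2 \<longrightarrow>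
        ereal (curve_length F s1 s2 \<gamma>) = F_dist F M (\<gamma> s1) (\<gamma> s2))"

text \<open>Unit-speed geodesic on \<open>{0..l}\<close> leaving \<open>A\<close> orthogonally. For \<open>A = {p}\<close> the tangent space
  is trivial, so all initial directions are allowed.\<close>

definition orthogonal_geodesic ::
  "('a \<Rightarrow> real) \<Rightarrow> 'a::euclidean_space set \<Rightarrow> 'a set \<Rightarrow> real \<Rightarrow> (real \<Rightarrow> 'a) \<Rightarrow> bool" where
  "orthogonal_geodesic F M A l \<gamma> \<longleftrightarrow> F_geodesic F M l \<gamma> \<and> unit_speed F l \<gamma> \<and> \<gamma> 0 \<in> A \<and>
     F_orthogonal F A (\<gamma> 0) (vector_derivative \<gamma> (at 0 within {0..l}))"


section \<open>The fire model\<close>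

text \<open>The fire is stopped before cut loci or singularities: orthogonal geodesics can be continued
  in \<open>M\<close> up to time \<open>r\<close> and minimize the distance from \<open>A\<close>, and they reach every point at
  distance at most \<open>r\<close>.\<close>

definition admissible_time ::
  "('a \<Rightarrow> real) \<Rightarrow> 'a::euclidean_space set \<Rightarrow> 'a set \<Rightarrow> real \<Rightarrow> bool" where
  "admissible_time F M A r \<longleftrightarrow> 0 < r \<and>
     (\<forall>l \<gamma>. 0 < l \<and> orthogonal_geodesic F M A l \<gamma> \<longrightarrow>
        (\<exists>\<eta>. orthogonal_geodesic F M A r \<eta> \<and> (\<forall>t\<in>{0..min l r}. \<eta> t = \<gamma> t) \<and>
             (\<forall>t\<in>{0..r}. F_setdist F M A (\<eta> t) = ereal t))) \<and>
     (\<forall>q\<in>M. \<forall>t. 0 < t \<and> t \<le> r \<and> F_setdist F M A q = ereal t \<longrightarrow>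
        (\<exists>\<gamma>. orthogonal_geodesic F M A r \<gamma> \<and> \<gamma> t = q))"

definition wavefront ::
  "('a \<Rightarrow> real) \<Rightarrow> 'a::euclidean_space set \<Rightarrow> 'a set \<Rightarrow> real \<Rightarrow> 'a set" where
  "wavefront F M A \<tau> = {q \<in> M. F_setdist F M A q = ereal \<tau>}"

definition spherical_wavefront ::
  "('a \<Rightarrow> real) \<Rightarrow> 'a::euclidean_space set \<Rightarrow> 'a \<Rightarrow> real \<Rightarrow> 'a set" where
  "spherical_wavefront F M p \<tau> = wavefront F M {p} \<tau>"

definition wave_ray ::
  "('a \<Rightarrow> real) \<Rightarrow> 'a::euclidean_space set \<Rightarrow> 'a set \<Rightarrow> real \<Rightarrow> (real \<Rightarrow> 'a) \<Rightarrow> bool" where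
  "wave_ray F M A l \<gamma> \<longleftrightarrow> piecewise_smooth_curve 0 l \<gamma> \<and> \<gamma> ` {0..l} \<subseteq> M \<and> \<gamma> 0 \<in> A \<and>
     unit_speed F l \<gamma> \<and> (\<forall>t\<in>{0..l}. F_setdist F M A (\<gamma> t) = ereal t)"


section \<open>The ellipsoidal metric\<close>

definition Q_ell :: "real \<Rightarrow> real \<Rightarrow> real \<Rightarrow> real \<Rightarrow> real^3 \<Rightarrow> real" where
  "Q_ell a b c \<alpha> x =
     (x $ 1 / a)\<^sup>2 + ((x $ 2 * cos \<alpha> - x $ 3 * sin \<alpha>) / b)\<^sup>2
     + ((x $ 2 * sin \<alpha> + x $ 3 * cos \<alpha>) / c)\<^sup>2"

text \<open>The Hessian of the quadratic form is constant; it is taken at the origin.\<close>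

definition ell_metric :: "real \<Rightarrow> real \<Rightarrow> real \<Rightarrow> real \<Rightarrow> real^3 \<Rightarrow> real^3 \<Rightarrow> real" where
  "ell_metric a b c \<alpha> X Y = hessian (Q_ell a b c \<alpha>) 0 X Y / 2"

end

theory Submission
  imports Defs
begin

text \<open>Because the metric does not depend on the point, everything reduces to convex geometry of the
  indicatrix \<open>F V = 1\<close>, which by the Zermelo construction is the \<open>h\<close>-unit sphere translated by
  \<open>W\<close> (lemma \<open>indicatrix\<close>). At each of its points the tangent plane is a strict support plane: the
  linear form \<open>h (V - W) U / h (V - W) V\<close> is bounded by \<open>F U\<close>, with equality only for non-negative
  multiples of \<open>V\<close> (\<open>zermelo_support\<close>); this is the Cauchy-Schwarz inequality for \<open>h\<close> and its
  equality case.

  The locale \<open>strictly_convex_gauge\<close> abstracts exactly this. Integrating a support functional along a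
  curve from \<open>p\<close> to \<open>q\<close> bounds its length below by \<open>F (q - p)\<close>, so segments inside \<open>M\<close> are shortest
  (\<open>F_dist_segment\<close>), and strictness of the support makes equality in the triangle inequality force
  parallel vectors (\<open>F_triangle_eqD\<close>). Hence a unit-speed curve whose short pieces are all shortest
  is a straight line (\<open>affine_if_locally_additive\<close>): only short pieces can be compared with segments,
  as \<open>M\<close> is open but need not be convex, and connectedness of the parameter interval glues them.
  So the unit-speed geodesics orthogonal to \<open>A\<close> are the lines \<open>p + t V\<close> with \<open>F V = 1\<close> and \<open>V\<close>
  \<open>F\<close>-orthogonal to \<open>A\<close> at \<open>p\<close> (\<open>orthogonal_geodesic_iff\<close>).

  The admissibility of the time \<open>r\<close> then identifies wavefronts with the end points of such lines
  (\<open>wavefront_eq\<close>). For wave rays there is one more point: a ray is straight, but its direction has to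
  be shown orthogonal to \<open>A\<close>. A point half-way along the ray is also reached by some orthogonal line,
  a priori from another point of \<open>A\<close>; following that line and then the ray is again a fastest path,
  so it has no corner, and the orthogonal line is the ray itself (\<open>wave_ray_orthogonal\<close>).

  Finally, differentiating \<open>F\<^sup>2\<close> shows that \<open>g\<^sub>V V U\<close> is the support functional above
  (\<open>fundamental_tensor_zermelo\<close>), so \<open>F\<close>-orthogonality of a unit vector \<open>V\<close> is \<open>h\<close>-orthogonality of
  \<open>V - W\<close>. Spherical wavefronts are the case \<open>A = {p}\<close>, where every direction is orthogonal.\<close>

section \<open>Smooth and piecewise smooth curves\<close>

lemma C_on_const: "C_on n (\<lambda>x. c) S"
  by (induction n arbitrary: c) (auto simp: frechet_derivative_const)

lemma smooth_map_on_affine: "smooth_map_on (\<lambda>t::real. p + t *\<^sub>R V) S"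
  unfolding smooth_map_on_def
proof
  fix n
  have d: "((\<lambda>t::real. p + t *\<^sub>R V) has_derivative (\<lambda>v. v *\<^sub>R V)) (at x)" for x
    by (auto intro!: derivative_eq_intros)
  have f: "frechet_derivative (\<lambda>t::real. p + t *\<^sub>R V) (at x) = (\<lambda>v. v *\<^sub>R V)" for x
    using frechet_derivative_at[OF d] by simp
  show "C_on n (\<lambda>t::real. p + t *\<^sub>R V) S"
  proof (cases n)
    case 0
    then show ?thesis by (auto intro!: continuous_intros)
  next
    case (Suc m)
    then show ?thesis
      using d by (auto simp: f C_on_const differentiable_def)
  qed
qed

lemma smooth_curve_affine:
  assumes "\<And>t. t \<in> {a..b} \<Longrightarrow> \<gamma> t = p + t *\<^sub>R V"
  shows "smooth_curve a b \<gamma>"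
  unfolding smooth_curve_def
  using smooth_map_on_affine[of p V UNIV] assms
  by (intro exI[of _ UNIV] exI[of _ "\<lambda>t. p + t *\<^sub>R V"]) auto

lemma smooth_curve_derivative:
  fixes \<gamma> :: "real \<Rightarrow> 'a::real_normed_vector"
  assumes "smooth_curve a b \<gamma>"
  obtains D where "continuous_on {a..b} D"
    "\<And>t. t \<in> {a..b} \<Longrightarrow> (\<gamma> has_vector_derivative D t) (at t within {a..b})"
proof -
  from assms obtain J \<delta> where J: "open J" "{a..b} \<subseteq> J" "smooth_map_on \<delta> J"
    and eq: "\<And>t. t \<in> {a..b} \<Longrightarrow> \<delta> t = \<gamma> t"
    unfolding smooth_curve_def by blast
  define D where "D x = frechet_derivative \<delta> (at x) 1" for x
  have "C_on 1 \<delta> J" using J(3) by (simp add: smooth_map_on_def)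
  then have diff: "\<And>x. x \<in> J \<Longrightarrow> \<delta> differentiable (at x)" and cont: "continuous_on J D"
    by (auto simp: D_def)
  show ?thesis
  proof
    show "continuous_on {a..b} D" using cont J(2) by (rule continuous_on_subset)
  next
    fix t assume t: "t \<in> {a..b}"
    have "\<delta> differentiable (at t)" using diff t J(2) by blast
    then have "(\<delta> has_vector_derivative D t) (at t)"
      unfolding D_def by (simp add: frechet_derivative_eq_vector_derivative flip: vector_derivative_works)
    then have "(\<delta> has_vector_derivative D t) (at t within {a..b})"
      by (rule has_vector_derivative_at_within)
    then show "(\<gamma> has_vector_derivative D t) (at t within {a..b})"
      by (rule has_vector_derivative_transform[rotated 2]) (use t eq in auto)
  qed
qed

lemma affine_imp_piecewise_smooth_curve:
  assumes "\<And>t. t \<in> {a..b} \<Longrightarrow> \<gamma> t = p + t *\<^sub>R V"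
  shows "piecewise_smooth_curve a b \<gamma>"
  unfolding piecewise_smooth_curve_def
proof (intro conjI exI[of _ "{}"] allI impI)
  show "continuous_on {a..b} \<gamma>"
    by (rule continuous_on_eq[of _ "\<lambda>t. p + t *\<^sub>R V"]) (use assms in \<open>auto intro!: continuous_intros\<close>)
  show "smooth_curve s t \<gamma>" if "a \<le> s \<and> s < t \<and> t \<le> b \<and> {s<..<t} \<inter> {} = {}" for s t
    by (rule smooth_curve_affine[of _ _ _ p V]) (use that assms in auto)
qed auto

lemma piecewise_smooth_curve_derivative:
  fixes \<gamma> :: "real \<Rightarrow> 'a::real_normed_vector"
  assumes "piecewise_smooth_curve a b \<gamma>"
  obtains T where "finite T"
    "\<And>t. t \<in> {a<..<b} - T \<Longrightarrow> (\<gamma> has_vector_derivative vector_derivative \<gamma> (at t)) (at t)"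
proof -
  from assms obtain T where T: "finite T"
    and sm: "\<And>s t. a \<le> s \<and> s < t \<and> t \<le> b \<and> {s<..<t} \<inter> T = {} \<Longrightarrow> smooth_curve s t \<gamma>"
    unfolding piecewise_smooth_curve_def by blast
  have "(\<gamma> has_vector_derivative vector_derivative \<gamma> (at t)) (at t)"
    if t: "t \<in> {a<..<b} - T" for t
  proof -
    have "open ({a<..<b} - T)" using T by (intro open_Diff finite_imp_closed) auto
    with t obtain e where e: "e > 0" "cball t e \<subseteq> {a<..<b} - T"
      unfolding open_contains_cball by blast
    have sub: "{t - e..t + e} \<subseteq> {a<..<b} - T" using e(2) by (simp add: cball_eq_atLeastAtMost)
    have "t - e \<in> {a<..<b}" "t + e \<in> {a<..<b}"
      using e(1) subsetD[OF sub, of "t - e"] subsetD[OF sub, of "t + e"] by auto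
    moreover have "{t - e<..<t + e} \<inter> T = {}" using sub greaterThanLessThan_subseteq_atLeastAtMost_iff[of "t - e" "t + e"] by force
    ultimately have "smooth_curve (t - e) (t + e) \<gamma>"
      using e(1) by (intro sm) auto
    then obtain D where "\<And>u. u \<in> {t - e..t + e} \<Longrightarrow>
        (\<gamma> has_vector_derivative D u) (at u within {t - e..t + e})"
      using smooth_curve_derivative by blast
    from this[of t] have "(\<gamma> has_vector_derivative D t) (at t)"
      using e(1) by (simp add: at_within_Icc_at)
    then show ?thesis
      using vector_derivative_works differentiableI_vector by blast
  qed
  with T that show ?thesis by blast
qed

text \<open>Splitting the parameter interval at the break points reduces integrability to pieces on which
  the derivative extends continuously to the end points; this is more than continuity away from
  finitely many points, which would not rule out an unbounded derivative.\<close>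

lemma integrable_piecewise_smooth_curve:
  fixes \<gamma> :: "real \<Rightarrow> 'a::real_normed_vector" and F :: "'a \<Rightarrow> real"
  assumes F: "continuous_on UNIV F" and "finite T"
    and "\<And>s t. a \<le> s \<Longrightarrow> s < t \<Longrightarrow> t \<le> b \<Longrightarrow> {s<..<t} \<inter> T = {} \<Longrightarrow> smooth_curve s t \<gamma>"
  shows "(\<lambda>t. F (vector_derivative \<gamma> (at t))) integrable_on {a..b}"
  using assms(2,3)
proof (induction T arbitrary: a b rule: finite_induct)
  case empty
  show ?case
  proof (cases "a < b")
    case True
    then have "smooth_curve a b \<gamma>" using empty by simp
    then obtain D where D: "continuous_on {a..b} D"
      "\<And>t. t \<in> {a..b} \<Longrightarrow> (\<gamma> has_vector_derivative D t) (at t within {a..b})"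
      using smooth_curve_derivative by blast
    have "continuous_on {a..b} (\<lambda>t. F (D t))"
      using continuous_on_compose2[OF F D(1)] by simp
    then have "(\<lambda>t. F (D t)) integrable_on {a..b}" by (rule integrable_continuous_real)
    moreover have "vector_derivative \<gamma> (at t) = D t" if "t \<in> {a..b} - {a, b}" for t
      using D(2)[of t] that by (intro vector_derivative_at) (simp add: at_within_Icc_at)
    ultimately show ?thesis
      by (elim integrable_spike_finite[of "{a, b}", rotated 2]) auto
  next
    case False
    then have "{a..b} = {} \<or> {a..b} = cbox b b" by auto
    then show ?thesis using integrable_on_refl by (metis integrable_on_empty)
  qed
next
  case (insert x T)
  show ?case
  proof (cases "a < x \<and> x < b")
    case True
    have "(\<lambda>t. F (vector_derivative \<gamma> (at t))) integrable_on {a..x}"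
      by (rule insert.IH) (use True insert.prems in auto)
    moreover have "(\<lambda>t. F (vector_derivative \<gamma> (at t))) integrable_on {x..b}"
      by (rule insert.IH) (use True insert.prems in auto)
    ultimately show ?thesis
      using True by (intro Henstock_Kurzweil_Integration.integrable_combine[of a x b]) auto
  next
    case False
    show ?thesis
      by (rule insert.IH) (use False insert.prems in auto)
  qed
qed

lemma has_integral_curve_length:
  fixes \<gamma> :: "real \<Rightarrow> 'a::real_normed_vector" and F :: "'a \<Rightarrow> real"
  assumes "continuous_on UNIV F" "piecewise_smooth_curve a b \<gamma>"
  shows "((\<lambda>t. F (vector_derivative \<gamma> (at t))) has_integral curve_length F a b \<gamma>) {a..b}"
proof -
  have "(\<lambda>t. F (vector_derivative \<gamma> (at t))) integrable_on {a..b}"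
    using assms(2) integrable_piecewise_smooth_curve[OF assms(1)]
    unfolding piecewise_smooth_curve_def by metis
  moreover have "curve_length F a b \<gamma> = integral {a..b} (\<lambda>t. F (vector_derivative \<gamma> (at t)))"
    unfolding curve_length_def
    by (rule integral_spike[of "{a, b}"]) (auto simp: at_within_Icc_at)
  ultimately show ?thesis by (simp add: has_integral_integrable_integral)
qed

section \<open>Strictly convex asymmetric norms\<close>

text \<open>The last axiom provides a support functional at each point of the indicatrix that touches it at
  that point only. This one condition encodes both the triangle inequality and strict convexity.\<close>

locale strictly_convex_gauge =
  fixes F :: "'a::euclidean_space \<Rightarrow> real"
  assumes F_pos: "V \<noteq> 0 \<Longrightarrow> 0 < F V"
    and F_scale: "0 \<le> c \<Longrightarrow> F (c *\<^sub>R V) = c * F V"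
    and F_cont: "continuous_on UNIV F"
    and F_support: "F V = 1 \<Longrightarrow>
      \<exists>l. linear l \<and> l V = 1 \<and> (\<forall>U. l U \<le> F U) \<and> (\<forall>U. l U = F U \<longrightarrow> U = F U *\<^sub>R V)"
begin

lemma F_zero [simp]: "F 0 = 0"
  using F_scale[of 0 0] by simp

lemma F_nonneg [simp]: "0 \<le> F V"
  using F_pos[of V] by (cases "V = 0") auto

lemma F_normalize: "V \<noteq> 0 \<Longrightarrow> F ((1 / F V) *\<^sub>R V) = 1"
  using F_pos[of V] by (simp add: F_scale)

lemma F_support_at:
  assumes "X \<noteq> 0"
  obtains l where "linear l" "l X = F X" "\<And>U. l U \<le> F U"
    "\<And>U. l U = F U \<Longrightarrow> U = (F U / F X) *\<^sub>R X"
proof -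
  have pos: "F X > 0" using F_pos[OF assms] .
  obtain l where l: "linear l" "l ((1 / F X) *\<^sub>R X) = 1" "\<And>U. l U \<le> F U"
    "\<And>U. l U = F U \<Longrightarrow> U = F U *\<^sub>R (1 / F X) *\<^sub>R X"
    using F_support[OF F_normalize[OF assms]] by blast
  show ?thesis
    by (rule that[of l]) (use l pos in \<open>auto simp: linear_scale field_simps\<close>)
qed

text \<open>Integrate the functional supporting \<open>F\<close> in the direction of the chord: on the derivative it is at
  most \<open>F\<close>, and by the fundamental theorem of calculus its integral is exactly \<open>F\<close> of the chord.\<close>

lemma F_le_integral:
  assumes cont: "continuous_on {a..b} \<gamma>" and "a \<le> b" "finite T"
    and D: "\<And>t. t \<in> {a<..<b} - T \<Longrightarrow> (\<gamma> has_vector_derivative D t) (at t)"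
    and I: "((\<lambda>t. F (D t)) has_integral I) {a..b}"
  shows "F (\<gamma> b - \<gamma> a) \<le> I"
proof (cases "\<gamma> b = \<gamma> a")
  case True
  then show ?thesis using has_integral_nonneg[OF I] by simp
next
  case False
  define X where "X = \<gamma> b - \<gamma> a"
  have "X \<noteq> 0" using False by (simp add: X_def)
  then obtain l where l: "linear l" "l X = F X" "\<And>U. l U \<le> F U"
    using F_support_at by blast
  have bl: "bounded_linear l" using l(1) by (simp add: linear_conv_bounded_linear)
  have "(D has_integral X) {a..b}"
    unfolding X_def
    by (rule fundamental_theorem_of_calculus_interior_strong[OF \<open>finite T\<close> \<open>a \<le> b\<close>])
       (use D cont in auto)
  then have "((\<lambda>t. l (D t)) has_integral l X) {a..b}"
    using has_integral_linear[OF _ bl] by (simp add: o_def)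
  then have "l X \<le> I"
    by (rule has_integral_le[OF _ I]) (use l(3) in auto)
  then show ?thesis using l(2) X_def by simp
qed

text \<open>The functional supporting \<open>F\<close> at \<open>X + Y\<close> must then touch \<open>F\<close> at both \<open>X\<close> and \<open>Y\<close>, so both are
  multiples of \<open>X + Y\<close>.\<close>

lemma F_triangle_eqD:
  assumes "F (X + Y) \<ge> F X + F Y" "X \<noteq> 0"
  shows "Y = (F Y / F X) *\<^sub>R X"
proof -
  have posX: "F X > 0" using F_pos[OF assms(2)] .
  then have ne: "X + Y \<noteq> 0" using assms(1) F_nonneg[of Y] F_zero by (metis add_pos_nonneg not_le)
  then obtain l where l: "linear l" "l (X + Y) = F (X + Y)" "\<And>U. l U \<le> F U"
    "\<And>U. l U = F U \<Longrightarrow> U = (F U / F (X + Y)) *\<^sub>R (X + Y)"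
    using F_support_at by blast
  have "l X = F X" "l Y = F Y"
    using l(2) l(3)[of X] l(3)[of Y] linear_add[OF l(1), of X Y] assms(1) by linarith+
  then have X: "X = (F X / F (X + Y)) *\<^sub>R (X + Y)" and Y: "Y = (F Y / F (X + Y)) *\<^sub>R (X + Y)"
    using l(4) by blast+
  have "(F Y / F X) *\<^sub>R X = (F Y / F X) *\<^sub>R (F X / F (X + Y)) *\<^sub>R (X + Y)" using X by metis
  also have "\<dots> = (F Y / F (X + Y)) *\<^sub>R (X + Y)" using posX by (simp del: scaleR_add_right)
  finally show ?thesis using Y by metis
qed

section \<open>Distances realised by segments\<close>

lemma F_dist_ge: "ereal (F (q - p)) \<le> F_dist F M p q"
  unfolding F_dist_def
proof (rule INF_greatest)
  fix \<gamma> assume "\<gamma> \<in> curves_between M p q"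
  then have pw: "piecewise_smooth_curve 0 1 \<gamma>" and ends: "\<gamma> 0 = p" "\<gamma> 1 = q"
    by (auto simp: curves_between_def)
  obtain T where T: "finite T"
    "\<And>t. t \<in> {0<..<1} - T \<Longrightarrow> (\<gamma> has_vector_derivative vector_derivative \<gamma> (at t)) (at t)"
    using piecewise_smooth_curve_derivative[OF pw] by blast
  have "F (\<gamma> 1 - \<gamma> 0) \<le> curve_length F 0 1 \<gamma>"
    by (rule F_le_integral[OF _ _ T has_integral_curve_length[OF F_cont pw]])
       (use pw in \<open>auto simp: piecewise_smooth_curve_def\<close>)
  then show "ereal (F (q - p)) \<le> ereal (curve_length F 0 1 \<gamma>)" by (simp add: ends)
qed

text \<open>Two-piece polygons are the test curves behind every later use of the triangle inequality for the
  distance from \<open>A\<close>: before the cut locus, the first piece is the segment along which a point is reached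
  from \<open>A\<close>.\<close>

lemma F_dist_broken_line:
  assumes "closed_segment p x \<subseteq> M" "closed_segment x q \<subseteq> M"
  shows "F_dist F M p q \<le> ereal (F (x - p) + F (q - x))"
proof -
  define \<gamma> where "\<gamma> = linepath p x +++ linepath x q"
  have g1: "\<gamma> t = p + t *\<^sub>R (2 *\<^sub>R (x - p))" if "t \<in> {0..1/2}" for t
    using that unfolding \<gamma>_def joinpaths_def linepath_def by (simp add: algebra_simps)
  have g2: "\<gamma> t = (2 *\<^sub>R x - q) + t *\<^sub>R (2 *\<^sub>R (q - x))" if "t \<in> {1/2..1}" for t
  proof (cases "t = 1/2")
    case True
    have "2 *\<^sub>R v = v + v" "(1/2) *\<^sub>R v + (1/2) *\<^sub>R v = v" for v :: 'a
      by (simp_all add: scaleR_2 flip: scaleR_add_left)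
    then show ?thesis
      unfolding True \<gamma>_def joinpaths_def linepath_def by (simp add: algebra_simps)
  next
    case False
    then show ?thesis
      using that unfolding \<gamma>_def joinpaths_def linepath_def
      by (simp add: algebra_simps flip: scaleR_add_left)
  qed
  have pw: "piecewise_smooth_curve 0 1 \<gamma>"
    unfolding piecewise_smooth_curve_def
  proof (intro conjI exI[of _ "{1/2}"] allI impI)
    have "path \<gamma>" unfolding \<gamma>_def by simp
    then show "continuous_on {0..1} \<gamma>" by (simp add: path_def)
    show "smooth_curve s t \<gamma>"
      if "0 \<le> s \<and> s < t \<and> t \<le> 1 \<and> {s<..<t} \<inter> {1 / 2} = {}" for s t
    proof -
      from that have "t \<le> 1/2 \<or> 1/2 \<le> s" by auto
      then show ?thesis
      proof
        assume "t \<le> 1/2"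
        then show ?thesis by (intro smooth_curve_affine[OF g1]) (use that in auto)
      next
        assume "1/2 \<le> s"
        then show ?thesis by (intro smooth_curve_affine[OF g2]) (use that in auto)
      qed
    qed
  qed auto
  have vd: "vector_derivative \<gamma> (at t) = V"
    if "open S" "\<And>u. u \<in> S \<Longrightarrow> \<gamma> u = z + u *\<^sub>R V" "t \<in> S" for S t z V
  proof (rule vector_derivative_at)
    have "((\<lambda>u. z + u *\<^sub>R V) has_vector_derivative V) (at t)"
      by (auto intro!: derivative_eq_intros)
    then show "(\<gamma> has_vector_derivative V) (at t)"
      by (rule has_vector_derivative_transform_within_open[OF _ that(1,3)]) (use that(2) in auto)
  qed
  have "((\<lambda>t::real. 2 * F (x - p)) has_integral F (x - p)) {0..1/2}"
    using has_integral_const_real[of "2 * F (x - p)" 0 "1/2"] by simp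
  then have i1: "((\<lambda>t. F (vector_derivative \<gamma> (at t))) has_integral F (x - p)) {0..1/2}"
    by (rule has_integral_spike_finite[rotated 2, where S="{0,1/2}"])
       (use vd[of "{0<..<1/2}", OF _ g1] in \<open>auto simp: F_scale\<close>)
  have "((\<lambda>t::real. 2 * F (q - x)) has_integral F (q - x)) {1/2..1}"
    using has_integral_const_real[of "2 * F (q - x)" "1/2" 1] by simp
  then have i2: "((\<lambda>t. F (vector_derivative \<gamma> (at t))) has_integral F (q - x)) {1/2..1}"
    by (rule has_integral_spike_finite[rotated 2, where S="{1/2,1}"])
       (use vd[of "{1/2<..<1}", OF _ g2] in \<open>auto simp: F_scale\<close>)
  have "((\<lambda>t. F (vector_derivative \<gamma> (at t))) has_integral F (x - p) + F (q - x)) {0..1}"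
    by (rule has_integral_combine[OF _ _ i1 i2]) auto
  then have len: "curve_length F 0 1 \<gamma> = F (x - p) + F (q - x)"
    using has_integral_curve_length[OF F_cont pw] has_integral_unique by blast
  have "\<gamma> ` {0..1} \<subseteq> M"
    using subset_path_image_join[of "linepath p x" M "linepath x q"] assms
    unfolding \<gamma>_def path_image_def[symmetric] by simp
  then have "\<gamma> \<in> curves_between M p q"
    using pw g1[of 0] g2[of 1] by (auto simp: curves_between_def scaleR_2)
  then show ?thesis
    unfolding F_dist_def len[symmetric] by (rule INF_lower)
qed

lemma F_dist_segment:
  assumes "closed_segment p q \<subseteq> M"
  shows "F_dist F M p q = ereal (F (q - p))"
proof (rule antisym)
  have "p \<in> M" using assms by auto
  then show "F_dist F M p q \<le> ereal (F (q - p))"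
    using F_dist_broken_line[of p p M q] assms by simp
qed (rule F_dist_ge)


section \<open>Minimising curves are straight\<close>

text \<open>Near each parameter, additivity along a subdivision point is equality in the triangle inequality,
  which puts the point on the chord. Thus the derivative exists and is locally constant, hence
  constant on the connected interval.\<close>

lemma affine_if_locally_additive:
  assumes "0 < l"
    and loc: "\<And>t. t \<in> {0..l} \<Longrightarrow> \<exists>\<epsilon>>0. \<forall>s1\<in>{0..l}. \<forall>s2\<in>{0..l}.
        \<bar>s1 - t\<bar> < \<epsilon> \<and> \<bar>s2 - t\<bar> < \<epsilon> \<and> s1 < s2 \<longrightarrow> F (\<gamma> s2 - \<gamma> s1) = s2 - s1"
  obtains V where "F V = 1" "\<And>t. t \<in> {0..l} \<Longrightarrow> \<gamma> t = \<gamma> 0 + t *\<^sub>R V"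
proof -
  have loc_deriv: "\<exists>V. \<exists>d>0. \<forall>t\<in>{0..l}. \<bar>t - t0\<bar> < d \<longrightarrow>
      (\<gamma> has_vector_derivative V) (at t within {0..l})"
    if t0: "t0 \<in> {0..l}" for t0
  proof -
    obtain \<epsilon> where e: "\<epsilon> > 0" and add: "\<And>s1 s2. s1 \<in> {0..l} \<Longrightarrow> s2 \<in> {0..l} \<Longrightarrow>
        \<bar>s1 - t0\<bar> < \<epsilon> \<Longrightarrow> \<bar>s2 - t0\<bar> < \<epsilon> \<Longrightarrow> s1 < s2 \<Longrightarrow> F (\<gamma> s2 - \<gamma> s1) = s2 - s1"
      using loc[OF t0] by blast
    \<comment> \<open>The chord over a closed neighbourhood of \<open>t0\<close> in \<open>{0..l}\<close>, one-sided if \<open>t0\<close> is an end point.\<close>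
    define u w where "u = max 0 (t0 - \<epsilon>/2)" and "w = min l (t0 + \<epsilon>/2)"
    have uw: "u < w" "u \<in> {0..l}" "w \<in> {0..l}" "\<bar>u - t0\<bar> < \<epsilon>" "\<bar>w - t0\<bar> < \<epsilon>"
      using t0 e \<open>0 < l\<close> unfolding u_def w_def by auto
    define V where "V = (1 / (w - u)) *\<^sub>R (\<gamma> w - \<gamma> u)"
    have aff: "\<gamma> v = (\<gamma> u - u *\<^sub>R V) + v *\<^sub>R V" if v: "v \<in> {u..w}" for v
    proof (cases "v = u \<or> v = w")
      case True
      have "(w - u) *\<^sub>R V = \<gamma> w - \<gamma> u" using uw(1) by (simp add: V_def)
      then have "w *\<^sub>R V = \<gamma> w - \<gamma> u + u *\<^sub>R V" by (simp add: algebra_simps)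
      then show ?thesis using True by auto
    next
      case False
      define X Y where "X = \<gamma> v - \<gamma> u" and "Y = \<gamma> w - \<gamma> v"
      have v': "u < v" "v < w" "v \<in> {0..l}" "\<bar>v - t0\<bar> < \<epsilon>" using v False uw by auto
      have FX: "F X = v - u" "F Y = w - v" "F (X + Y) = w - u"
        using add uw v' unfolding X_def Y_def by auto
      then have "X \<noteq> 0" using v' by auto
      then have "Y = (F Y / F X) *\<^sub>R X" using FX by (intro F_triangle_eqD) auto
      then have "X + Y = (1 + (w - v) / (v - u)) *\<^sub>R X"
        using FX by (simp add: scaleR_add_left)
      also have "1 + (w - v) / (v - u) = (w - u) / (v - u)" using v' by (simp add: field_simps)
      finally have "X + Y = ((w - u) / (v - u)) *\<^sub>R X" .
      then have "(v - u) *\<^sub>R V = X"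
        using v' uw(1) unfolding V_def X_def Y_def by simp
      then show ?thesis unfolding X_def by (simp add: algebra_simps)
    qed
    have "(\<gamma> has_vector_derivative V) (at t within {0..l})"
      if t: "t \<in> {0..l}" "\<bar>t - t0\<bar> < \<epsilon>/2" for t
    proof (rule has_vector_derivative_transform_within)
      show "((\<lambda>v. (\<gamma> u - u *\<^sub>R V) + v *\<^sub>R V) has_vector_derivative V) (at t within {0..l})"
        by (auto intro!: derivative_eq_intros)
      show "0 < \<epsilon>/2 - \<bar>t - t0\<bar>" using t by simp
      show "\<gamma> u - u *\<^sub>R V + v *\<^sub>R V = \<gamma> v"
        if "v \<in> {0..l}" "dist v t < \<epsilon>/2 - \<bar>t - t0\<bar>" for v
        by (rule aff[symmetric]) (use that in \<open>auto simp: u_def w_def dist_real_def\<close>)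
    qed (use t in auto)
    then show ?thesis using e by (intro exI[of _ V] exI[of _ "\<epsilon>/2"]) auto
  qed
  define f where "f t = vector_derivative \<gamma> (at t within {0..l})" for t
  have f_eq: "f t = V" if "(\<gamma> has_vector_derivative V) (at t within {0..l})" "t \<in> {0..l}" for t V
    unfolding f_def using that \<open>0 < l\<close> by (intro vector_derivative_within_closed_interval) auto
  define V where "V = f 0"
  have const: "f t = V" if t: "t \<in> {0..l}" for t
    unfolding V_def
  proof (rule connected_local_const[of "{0..l}"])
    show "\<forall>t0\<in>{0..l}. eventually (\<lambda>t. f t0 = f t) (at t0 within {0..l})"
    proof
      fix t0 assume t0: "t0 \<in> {0..l}"
      then obtain U d where U: "d > 0" "\<And>t. t \<in> {0..l} \<Longrightarrow> \<bar>t - t0\<bar> < d \<Longrightarrow>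
          (\<gamma> has_vector_derivative U) (at t within {0..l})"
        using loc_deriv by blast
      then have "f t0 = f t" if "t \<in> {0..l}" "dist t t0 < d" for t
        using f_eq[OF U(2)] t0 that by (simp add: dist_real_def)
      then show "eventually (\<lambda>t. f t0 = f t) (at t0 within {0..l})"
        unfolding eventually_at using \<open>d > 0\<close> by blast
    qed
  qed (use t \<open>0 < l\<close> in auto)
  have der: "(\<gamma> has_vector_derivative V) (at t within {0..l})" if t: "t \<in> {0..l}" for t
  proof -
    obtain U where "(\<gamma> has_vector_derivative U) (at t within {0..l})"
      using loc_deriv[OF t] t by force
    then show ?thesis using f_eq const t by metis
  qed
  have "((\<lambda>t. \<gamma> t - t *\<^sub>R V) has_vector_derivative 0) (at t within {0..l})" if "t \<in> {0..l}" for t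
    by (rule derivative_eq_intros der[OF that] refl | simp)+
  then obtain c where c: "\<And>t. t \<in> {0..l} \<Longrightarrow> \<gamma> t - t *\<^sub>R V = c"
    using has_vector_derivative_zero_constant[of "{0..l}" "\<lambda>t. \<gamma> t - t *\<^sub>R V"] by auto
  have "c = \<gamma> 0" using c[of 0] \<open>0 < l\<close> by simp
  then have aff: "\<gamma> t = \<gamma> 0 + t *\<^sub>R V" if "t \<in> {0..l}" for t
    using c[OF that] by (simp add: algebra_simps)
  obtain \<epsilon> where e: "\<epsilon> > 0" and add: "\<And>s2. s2 \<in> {0..l} \<Longrightarrow> \<bar>s2\<bar> < \<epsilon> \<Longrightarrow> 0 < s2 \<Longrightarrow> F (\<gamma> s2 - \<gamma> 0) = s2"
    using loc[of 0] \<open>0 < l\<close> by fastforce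
  define s where "s = min l (\<epsilon>/2)"
  have s: "s \<in> {0..l}" "\<bar>s\<bar> < \<epsilon>" "0 < s" using e \<open>0 < l\<close> by (auto simp: s_def)
  have "F (s *\<^sub>R V) = s" using add[OF s] aff[OF s(1)] by simp
  then have "F V = 1" using s(3) by (simp add: F_scale)
  then show ?thesis using aff that by blast
qed

lemma locally_segments_in_open:
  fixes \<gamma> :: "real \<Rightarrow> 'a"
  assumes "open M" "continuous_on {0..l} \<gamma>" "\<gamma> ` {0..l} \<subseteq> M" "t \<in> {0..l}"
  obtains \<epsilon> where "\<epsilon> > 0" "\<And>s1 s2. s1 \<in> {0..l} \<Longrightarrow> s2 \<in> {0..l} \<Longrightarrow> \<bar>s1 - t\<bar> < \<epsilon> \<Longrightarrow>
      \<bar>s2 - t\<bar> < \<epsilon> \<Longrightarrow> closed_segment (\<gamma> s1) (\<gamma> s2) \<subseteq> M"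
proof -
  obtain e where e: "e > 0" "ball (\<gamma> t) e \<subseteq> M"
    using assms(1,3,4) by (metis image_subset_iff open_contains_ball)
  obtain d where d: "d > 0" "\<And>s. s \<in> {0..l} \<Longrightarrow> dist s t < d \<Longrightarrow> dist (\<gamma> s) (\<gamma> t) < e"
    using assms(2)[unfolded continuous_on_iff, rule_format, OF assms(4) e(1)] by blast
  show ?thesis
  proof
    show "closed_segment (\<gamma> s1) (\<gamma> s2) \<subseteq> M"
      if "s1 \<in> {0..l}" "s2 \<in> {0..l}" "\<bar>s1 - t\<bar> < d" "\<bar>s2 - t\<bar> < d" for s1 s2
    proof -
      have "\<gamma> s1 \<in> ball (\<gamma> t) e" "\<gamma> s2 \<in> ball (\<gamma> t) e"
        using d(2)[OF that(1)] d(2)[OF that(2)] that(3,4) unfolding mem_ball dist_real_def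
        by (metis dist_commute)+
      then show ?thesis using e(2) closed_segment_subset[OF _ _ convex_ball] by blast
    qed
  qed (use d in auto)
qed

lemma has_vector_derivative_affine:
  assumes "\<And>t. t \<in> {a..b} \<Longrightarrow> \<gamma> t = p + t *\<^sub>R V" "t \<in> {a..b}"
  shows "(\<gamma> has_vector_derivative V) (at t within {a..b})"
proof (rule has_vector_derivative_transform)
  show "((\<lambda>t. p + t *\<^sub>R V) has_vector_derivative V) (at t within {a..b})"
    by (auto intro!: derivative_eq_intros)
qed (use assms in auto)

lemma curve_length_if_unit_speed:
  assumes "smooth_curve 0 l \<gamma>" "unit_speed F l \<gamma>" "s1 \<in> {0..l}" "s2 \<in> {0..l}" "s1 < s2"
  shows "curve_length F s1 s2 \<gamma> = s2 - s1"
proof -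
  obtain D where D: "\<And>t. t \<in> {0..l} \<Longrightarrow> (\<gamma> has_vector_derivative D t) (at t within {0..l})"
    using smooth_curve_derivative[OF assms(1)] by blast
  have "F (vector_derivative \<gamma> (at t within {s1..s2})) = 1" if t: "t \<in> {s1..s2}" for t
  proof -
    have t': "t \<in> {0..l}" and sub: "{s1..s2} \<subseteq> {0..l}" using t assms by auto
    have "(\<gamma> has_vector_derivative D t) (at t within {s1..s2})"
      using has_vector_derivative_within_subset[OF D[OF t'] sub] .
    then have "vector_derivative \<gamma> (at t within {s1..s2}) = D t"
      using t assms(5) by (intro vector_derivative_within_closed_interval) auto
    moreover have "F (D t) = 1" using assms(2) D[OF t'] t' unfolding unit_speed_def by blast
    ultimately show ?thesis by simp
  qed
  then have "curve_length F s1 s2 \<gamma> = integral {s1..s2} (\<lambda>t. 1)"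
    unfolding curve_length_def by (intro integral_cong) auto
  then show ?thesis using assms(5) by simp
qed

lemma unit_speed_affine:
  assumes "\<And>t. t \<in> {0..l} \<Longrightarrow> \<gamma> t = p + t *\<^sub>R V" "0 < l" "F V = 1"
  shows "unit_speed F l \<gamma>"
  unfolding unit_speed_def
proof (intro ballI allI impI)
  fix t v assume t: "t \<in> {0..l}" and v: "(\<gamma> has_vector_derivative v) (at t within {0..l})"
  have "vector_derivative \<gamma> (at t within {0..l}) = v"
       "vector_derivative \<gamma> (at t within {0..l}) = V"
    using t v has_vector_derivative_affine[OF assms(1) t] assms(2)
    by (auto intro!: vector_derivative_within_closed_interval)
  then show "F v = 1" using assms(3) by simp
qed

lemma affine_closed_segment:
  fixes p V :: 'a
  assumes "\<And>t. t \<in> {0..l} \<Longrightarrow> p + t *\<^sub>R V \<in> M" "s1 \<in> {0..l}" "s2 \<in> {0..l}"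
  shows "closed_segment (p + s1 *\<^sub>R V) (p + s2 *\<^sub>R V) \<subseteq> M"
proof
  fix x assume "x \<in> closed_segment (p + s1 *\<^sub>R V) (p + s2 *\<^sub>R V)"
  then obtain u where u: "0 \<le> u" "u \<le> 1"
    and x: "x = (1 - u) *\<^sub>R (p + s1 *\<^sub>R V) + u *\<^sub>R (p + s2 *\<^sub>R V)"
    unfolding closed_segment_def by blast
  have "x = p + ((1 - u) * s1 + u * s2) *\<^sub>R V" unfolding x by (simp add: algebra_simps)
  moreover have "(1 - u) * s1 + u * s2 \<in> {0..l}"
    using convexD_alt[OF convex_real_interval(5) assms(2,3) u] by simp
  ultimately show "x \<in> M" using assms(1) by simp
qed

text \<open>Short pieces of a geodesic have chords inside \<open>M\<close>, where the distance is \<open>F\<close> of the chord; unit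
  speed turns the length of such a piece into its parameter length.\<close>

lemma orthogonal_geodesic_iff:
  assumes "open M" "0 < l"
  shows "orthogonal_geodesic F M A l \<gamma> \<longleftrightarrow> \<gamma> 0 \<in> A \<and>
    (\<exists>V. F V = 1 \<and> F_orthogonal F A (\<gamma> 0) V \<and> (\<forall>t\<in>{0..l}. \<gamma> t \<in> M \<and> \<gamma> t = \<gamma> 0 + t *\<^sub>R V))"
    (is "?G \<longleftrightarrow> _ \<and> (\<exists>V. ?L V)")
proof -
  have vel: "vector_derivative \<gamma> (at 0 within {0..l}) = V"
    if "\<And>t. t \<in> {0..l} \<Longrightarrow> \<gamma> t = \<gamma> 0 + t *\<^sub>R V" for V
    using assms(2) has_vector_derivative_affine[OF that]
    by (intro vector_derivative_within_closed_interval) auto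
  show ?thesis
  proof (intro iffI conjI)
    assume G: ?G
    then show "\<gamma> 0 \<in> A" by (simp add: orthogonal_geodesic_def)
    have sm: "smooth_curve 0 l \<gamma>" and inM: "\<gamma> ` {0..l} \<subseteq> M" and us: "unit_speed F l \<gamma>"
      and shortest: "\<And>t. t \<in> {0..l} \<Longrightarrow> \<exists>\<epsilon>>0. \<forall>s1\<in>{0..l}. \<forall>s2\<in>{0..l}.
        \<bar>s1 - t\<bar> < \<epsilon> \<and> \<bar>s2 - t\<bar> < \<epsilon> \<and> s1 < s2 \<longrightarrow>
        ereal (curve_length F s1 s2 \<gamma>) = F_dist F M (\<gamma> s1) (\<gamma> s2)"
      using G unfolding orthogonal_geodesic_def F_geodesic_def by blast+
    obtain D where "\<And>t. t \<in> {0..l} \<Longrightarrow> (\<gamma> has_vector_derivative D t) (at t within {0..l})"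
      using smooth_curve_derivative[OF sm] by blast
    then have cont: "continuous_on {0..l} \<gamma>"
      by (meson continuous_on_eq_continuous_within has_vector_derivative_continuous)
    have loc: "\<exists>\<epsilon>>0. \<forall>s1\<in>{0..l}. \<forall>s2\<in>{0..l}.
        \<bar>s1 - t\<bar> < \<epsilon> \<and> \<bar>s2 - t\<bar> < \<epsilon> \<and> s1 < s2 \<longrightarrow> F (\<gamma> s2 - \<gamma> s1) = s2 - s1"
      if t: "t \<in> {0..l}" for t
    proof -
      obtain \<epsilon>1 where e1: "\<epsilon>1 > 0" "\<And>s1 s2. s1 \<in> {0..l} \<Longrightarrow> s2 \<in> {0..l} \<Longrightarrow> \<bar>s1 - t\<bar> < \<epsilon>1 \<Longrightarrow>
          \<bar>s2 - t\<bar> < \<epsilon>1 \<Longrightarrow> closed_segment (\<gamma> s1) (\<gamma> s2) \<subseteq> M"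
        using locally_segments_in_open[OF assms(1) cont inM t] by blast
      obtain \<epsilon>2 where e2: "\<epsilon>2 > 0" "\<And>s1 s2. s1 \<in> {0..l} \<Longrightarrow> s2 \<in> {0..l} \<Longrightarrow> \<bar>s1 - t\<bar> < \<epsilon>2 \<Longrightarrow>
          \<bar>s2 - t\<bar> < \<epsilon>2 \<Longrightarrow> s1 < s2 \<Longrightarrow> ereal (curve_length F s1 s2 \<gamma>) = F_dist F M (\<gamma> s1) (\<gamma> s2)"
        using shortest[OF t] by blast
      have "F (\<gamma> s2 - \<gamma> s1) = s2 - s1"
        if "s1 \<in> {0..l}" "s2 \<in> {0..l}" "\<bar>s1 - t\<bar> < min \<epsilon>1 \<epsilon>2" "\<bar>s2 - t\<bar> < min \<epsilon>1 \<epsilon>2" "s1 < s2" for s1 s2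
      proof -
        have "F_dist F M (\<gamma> s1) (\<gamma> s2) = ereal (F (\<gamma> s2 - \<gamma> s1))"
          using that by (intro F_dist_segment e1(2)) auto
        then show ?thesis
          using e2(2)[of s1 s2] that curve_length_if_unit_speed[OF sm us that(1,2,5)] by simp
      qed
      then show ?thesis using e1(1) e2(1) by (intro exI[of _ "min \<epsilon>1 \<epsilon>2"]) auto
    qed
    obtain V where V: "F V = 1" "\<And>t. t \<in> {0..l} \<Longrightarrow> \<gamma> t = \<gamma> 0 + t *\<^sub>R V"
      using affine_if_locally_additive[of l \<gamma>, OF assms(2) loc] by blast
    moreover have "F_orthogonal F A (\<gamma> 0) V"
      using G vel[OF V(2)] unfolding orthogonal_geodesic_def by simp
    ultimately show "\<exists>V. ?L V" using inM by blast
  next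
    assume "\<gamma> 0 \<in> A \<and> (\<exists>V. ?L V)"
    then obtain V where 0: "\<gamma> 0 \<in> A" and V: "F V = 1" "F_orthogonal F A (\<gamma> 0) V"
      and inM: "\<And>t. t \<in> {0..l} \<Longrightarrow> \<gamma> t \<in> M" and aff: "\<And>t. t \<in> {0..l} \<Longrightarrow> \<gamma> t = \<gamma> 0 + t *\<^sub>R V"
      by blast
    have sm: "smooth_curve 0 l \<gamma>" by (rule smooth_curve_affine[OF aff])
    have us: "unit_speed F l \<gamma>" by (rule unit_speed_affine[OF aff assms(2) V(1)])
    have "ereal (curve_length F s1 s2 \<gamma>) = F_dist F M (\<gamma> s1) (\<gamma> s2)"
      if s: "s1 \<in> {0..l}" "s2 \<in> {0..l}" "s1 < s2" for s1 s2
    proof -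
      have "closed_segment (\<gamma> 0 + s1 *\<^sub>R V) (\<gamma> 0 + s2 *\<^sub>R V) \<subseteq> M"
        by (rule affine_closed_segment[OF _ s(1,2)]) (use inM aff in metis)
      then have "F_dist F M (\<gamma> s1) (\<gamma> s2) = ereal (F (\<gamma> s2 - \<gamma> s1))"
        using aff[OF s(1)] aff[OF s(2)] by (intro F_dist_segment) simp
      also have "\<gamma> s2 - \<gamma> s1 = (s2 - s1) *\<^sub>R V"
        unfolding aff[OF s(1)] aff[OF s(2)] by (simp add: scaleR_left_diff_distrib)
      finally show ?thesis
        using s V(1) curve_length_if_unit_speed[OF sm us s] by (simp add: F_scale)
    qed
    then have "F_geodesic F M l \<gamma>"
      unfolding F_geodesic_def using sm inM by (auto intro!: exI[of _ "1::real"])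
    then show ?G
      unfolding orthogonal_geodesic_def using us 0 V(2) vel[OF aff] by simp
  qed
qed

lemma orthogonal_geodesicE:
  assumes "orthogonal_geodesic F M A l \<gamma>" "open M" "0 < l"
  obtains V where "\<gamma> 0 \<in> A" "F V = 1" "F_orthogonal F A (\<gamma> 0) V"
    "\<And>t. t \<in> {0..l} \<Longrightarrow> \<gamma> t \<in> M" "\<And>t. t \<in> {0..l} \<Longrightarrow> \<gamma> t = \<gamma> 0 + t *\<^sub>R V"
proof -
  from assms have "\<gamma> 0 \<in> A" and ex: "\<exists>V. F V = 1 \<and> F_orthogonal F A (\<gamma> 0) V \<and>
      (\<forall>t\<in>{0..l}. \<gamma> t \<in> M \<and> \<gamma> t = \<gamma> 0 + t *\<^sub>R V)"
    by (simp_all only: orthogonal_geodesic_iff)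
  from ex obtain V where V: "F V = 1" "F_orthogonal F A (\<gamma> 0) V"
    and aff: "\<forall>t\<in>{0..l}. \<gamma> t \<in> M \<and> \<gamma> t = \<gamma> 0 + t *\<^sub>R V"
    by (elim exE conjE) (rule that)
  show ?thesis
    by (rule that[OF \<open>\<gamma> 0 \<in> A\<close> V])
       (erule aff[rule_format, THEN conjunct1] aff[rule_format, THEN conjunct2])+
qed

section \<open>Wavefronts and wave rays before the cut locus\<close>

text \<open>A short initial piece of the line stays in the open set \<open>M\<close> and is an orthogonal geodesic.
  Admissibility prolongs it to time \<open>r\<close>, and the prolongation, being straight and equal to the line on
  an initial interval, is the line itself.\<close>

lemma admissible_line:
  assumes M: "open M" "A \<subseteq> M" and adm: "admissible_time F M A r"
    and p: "p \<in> A" and V: "F V = 1" "F_orthogonal F A p V" and t: "t \<in> {0..r}"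
  shows "p + t *\<^sub>R V \<in> M" "F_setdist F M A (p + t *\<^sub>R V) = ereal t"
proof -
  have r: "0 < r" using adm by (simp add: admissible_time_def)
  obtain e where e: "e > 0" "ball p e \<subseteq> M"
    using M p by (metis open_contains_ball subsetD)
  define l where "l = e / (norm V + 1)"
  have l: "l > 0" "l * norm V < e"
    using e(1) unfolding l_def by (auto simp: field_simps add_pos_nonneg)
  have "p + u *\<^sub>R V \<in> M" if u: "u \<in> {0..l}" for u
  proof -
    have "u * norm V \<le> l * norm V" using u by (intro mult_right_mono) auto
    then have "dist p (p + u *\<^sub>R V) < e" using u l(2) by (simp add: dist_norm)
    then show ?thesis using e(2) by (auto simp: mem_ball)
  qed
  then have "orthogonal_geodesic F M A l (\<lambda>u. p + u *\<^sub>R V)"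
    using p V by (subst orthogonal_geodesic_iff[OF M(1) l(1)]) auto
  then obtain \<eta> where \<eta>: "orthogonal_geodesic F M A r \<eta>"
    "\<And>u. u \<in> {0..min l r} \<Longrightarrow> \<eta> u = p + u *\<^sub>R V"
    "\<And>u. u \<in> {0..r} \<Longrightarrow> F_setdist F M A (\<eta> u) = ereal u"
    using adm l(1) unfolding admissible_time_def by blast
  obtain V' where V': "\<And>u. u \<in> {0..r} \<Longrightarrow> \<eta> u \<in> M" "\<And>u. u \<in> {0..r} \<Longrightarrow> \<eta> u = \<eta> 0 + u *\<^sub>R V'"
    by (rule orthogonal_geodesicE[OF \<eta>(1) M(1) r]) (rule that)
  define m where "m = min l r"
  have m: "m > 0" "m \<in> {0..min l r}" "m \<in> {0..r}" using l r by (auto simp: m_def)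
  have "\<eta> 0 = p" using \<eta>(2)[of 0] l(1) r by simp
  then have "V = V'" using \<eta>(2)[OF m(2)] V'(2)[OF m(3)] m(1) by auto
  then have "\<eta> t = p + t *\<^sub>R V" using V'(2)[OF t] \<open>\<eta> 0 = p\<close> by simp
  then show "p + t *\<^sub>R V \<in> M" "F_setdist F M A (p + t *\<^sub>R V) = ereal t"
    using V'(1)[OF t] \<eta>(3)[OF t] by simp_all
qed

lemma admissible_reach:
  assumes "open M" "admissible_time F M A r" "q \<in> M" "0 < t" "t \<le> r"
    "F_setdist F M A q = ereal t"
  obtains p V where "p \<in> A" "F V = 1" "F_orthogonal F A p V" "q = p + t *\<^sub>R V"
proof -
  have "0 < r" using assms by simp
  obtain \<gamma> where \<gamma>: "orthogonal_geodesic F M A r \<gamma>" "\<gamma> t = q"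
    using assms unfolding admissible_time_def by blast
  obtain V where V: "\<gamma> 0 \<in> A" "F V = 1" "F_orthogonal F A (\<gamma> 0) V"
    and aff: "\<And>u. u \<in> {0..r} \<Longrightarrow> \<gamma> u = \<gamma> 0 + u *\<^sub>R V"
    by (rule orthogonal_geodesicE[OF \<gamma>(1) assms(1) \<open>0 < r\<close>]) (rule that)
  have "q = \<gamma> 0 + t *\<^sub>R V" using aff[of t] \<gamma>(2) assms(4,5) by simp
  then show ?thesis using V that by blast
qed

theorem wavefront_eq:
  assumes "open M" "A \<subseteq> M" "admissible_time F M A r" "0 < \<tau>" "\<tau> \<le> r"
  shows "wavefront F M A \<tau> = {p + \<tau> *\<^sub>R V | p V. p \<in> A \<and> F V = 1 \<and> F_orthogonal F A p V}"
proof (intro set_eqI iffI)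
  fix q assume "q \<in> wavefront F M A \<tau>"
  then have "q \<in> M" "F_setdist F M A q = ereal \<tau>" by (simp_all add: wavefront_def)
  then obtain p V where "p \<in> A" "F V = 1" "F_orthogonal F A p V" "q = p + \<tau> *\<^sub>R V"
    by (rule admissible_reach[OF assms(1,3) _ assms(4,5)])
  then show "q \<in> {p + \<tau> *\<^sub>R V | p V. p \<in> A \<and> F V = 1 \<and> F_orthogonal F A p V}" by blast
next
  fix q assume "q \<in> {p + \<tau> *\<^sub>R V | p V. p \<in> A \<and> F V = 1 \<and> F_orthogonal F A p V}"
  then obtain p V where "p \<in> A" "F V = 1" "F_orthogonal F A p V" and q: "q = p + \<tau> *\<^sub>R V"
    by blast
  from admissible_line[OF assms(1-3) this(1-3), of \<tau>] assms(4,5)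
  show "q \<in> wavefront F M A \<tau>" unfolding wavefront_def q by simp
qed

lemma F_setdist_le:
  assumes "p \<in> A" "closed_segment p q \<subseteq> M"
  shows "F_setdist F M A q \<le> ereal (F (q - p))"
  unfolding F_setdist_def using assms F_dist_segment[of p q M] by (metis INF_lower)

lemma F_setdist_orthogonal_then_segment:
  assumes M: "open M" "A \<subseteq> M" and adm: "admissible_time F M A r"
    and p: "p \<in> A" and V: "F V = 1" "F_orthogonal F A p V" and s: "s \<in> {0..r}"
    and seg: "closed_segment (p + s *\<^sub>R V) q \<subseteq> M"
  shows "F_setdist F M A q \<le> ereal (s + F (q - (p + s *\<^sub>R V)))"
proof -
  have "closed_segment (p + 0 *\<^sub>R V) (p + s *\<^sub>R V) \<subseteq> M"
    using s admissible_line(1)[OF M adm p V] by (intro affine_closed_segment[of r]) auto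
  then have "F_dist F M p q \<le> ereal (F (p + s *\<^sub>R V - p) + F (q - (p + s *\<^sub>R V)))"
    using seg by (intro F_dist_broken_line) simp_all
  also have "F (p + s *\<^sub>R V - p) = s" using s V(1) by (simp add: F_scale)
  finally show ?thesis
    unfolding F_setdist_def using p by (meson INF_lower order_trans)
qed

text \<open>Unit speed bounds \<open>F\<close> of a chord above by the elapsed time. For the lower bound, join the
  orthogonal line reaching the initial point of the chord to the chord: a faster chord would reach
  its end point too early.\<close>

lemma wave_ray_affine:
  assumes M: "open M" "A \<subseteq> M" and adm: "admissible_time F M A r"
    and \<tau>: "0 < \<tau>" "\<tau> \<le> r" and ray: "wave_ray F M A \<tau> \<gamma>"
  obtains V where "F V = 1" "\<And>t. t \<in> {0..\<tau>} \<Longrightarrow> \<gamma> t = \<gamma> 0 + t *\<^sub>R V"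
proof -
  have pw: "piecewise_smooth_curve 0 \<tau> \<gamma>" and inM: "\<gamma> ` {0..\<tau>} \<subseteq> M" and 0: "\<gamma> 0 \<in> A"
    and us: "unit_speed F \<tau> \<gamma>"
    and dist: "\<And>t. t \<in> {0..\<tau>} \<Longrightarrow> F_setdist F M A (\<gamma> t) = ereal t"
    using ray by (auto simp: wave_ray_def)
  have cont: "continuous_on {0..\<tau>} \<gamma>" using pw by (simp add: piecewise_smooth_curve_def)
  obtain T where T: "finite T" and D: "\<And>t. t \<in> {0<..<\<tau>} - T \<Longrightarrow>
      (\<gamma> has_vector_derivative vector_derivative \<gamma> (at t)) (at t)"
    using piecewise_smooth_curve_derivative[OF pw] by blast
  have le: "F (\<gamma> s2 - \<gamma> s1) \<le> s2 - s1"
    if s: "s1 \<in> {0..\<tau>}" "s2 \<in> {0..\<tau>}" "s1 < s2" for s1 s2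
  proof (rule F_le_integral[OF _ _ T])
    show "continuous_on {s1..s2} \<gamma>" by (rule continuous_on_subset[OF cont]) (use s in auto)
    show "(\<gamma> has_vector_derivative vector_derivative \<gamma> (at t)) (at t)"
      if "t \<in> {s1<..<s2} - T" for t using D that s by auto
    have one: "F (vector_derivative \<gamma> (at t)) = 1" if t: "t \<in> {s1..s2} - ({s1, s2} \<union> T)" for t
    proof -
      have "t \<in> {0<..<\<tau>} - T" using t s by auto
      then show ?thesis
        using us has_vector_derivative_at_within[OF D] unfolding unit_speed_def by force
    qed
    have "((\<lambda>t. 1) has_integral s2 - s1) {s1..s2}"
      using has_integral_const_real[of "1::real" s1 s2] s(3) by simp
    then show "((\<lambda>t. F (vector_derivative \<gamma> (at t))) has_integral s2 - s1) {s1..s2}"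
      by (rule has_integral_spike_finite[rotated 2, where S="{s1, s2} \<union> T"]) (use one T in auto)
  qed (use s in auto)
  have ge: "s2 - s1 \<le> F (\<gamma> s2 - \<gamma> s1)"
    if s: "s1 \<in> {0..\<tau>}" "s2 \<in> {0..\<tau>}" "s1 < s2"
      and seg: "closed_segment (\<gamma> s1) (\<gamma> s2) \<subseteq> M" for s1 s2
  proof (cases "s1 = 0")
    case True
    then have "F_setdist F M A (\<gamma> s2) \<le> ereal (F (\<gamma> s2 - \<gamma> s1))"
      using F_setdist_le[OF 0, of "\<gamma> s2" M] seg by simp
    then show ?thesis using dist[OF s(2)] True by simp
  next
    case False
    have "\<gamma> s1 \<in> M" "0 < s1" "s1 \<le> r" using inM s False \<tau> by auto
    then obtain p V where pV: "p \<in> A" "F V = 1" "F_orthogonal F A p V" "\<gamma> s1 = p + s1 *\<^sub>R V"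
      by (rule admissible_reach[OF M(1) adm _ _ _ dist[OF s(1)]])
    have "F_setdist F M A (\<gamma> s2) \<le> ereal (s1 + F (\<gamma> s2 - (p + s1 *\<^sub>R V)))"
      by (rule F_setdist_orthogonal_then_segment[OF M adm pV(1-3)])
         (use seg pV(4) \<open>0 < s1\<close> \<open>s1 \<le> r\<close> in auto)
    then show ?thesis using dist[OF s(2)] pV(4) by simp
  qed
  have "\<exists>\<epsilon>>0. \<forall>s1\<in>{0..\<tau>}. \<forall>s2\<in>{0..\<tau>}.
      \<bar>s1 - t\<bar> < \<epsilon> \<and> \<bar>s2 - t\<bar> < \<epsilon> \<and> s1 < s2 \<longrightarrow> F (\<gamma> s2 - \<gamma> s1) = s2 - s1"
    if t: "t \<in> {0..\<tau>}" for t
  proof -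
    obtain \<epsilon> where "\<epsilon> > 0" "\<And>s1 s2. s1 \<in> {0..\<tau>} \<Longrightarrow> s2 \<in> {0..\<tau>} \<Longrightarrow> \<bar>s1 - t\<bar> < \<epsilon> \<Longrightarrow>
        \<bar>s2 - t\<bar> < \<epsilon> \<Longrightarrow> closed_segment (\<gamma> s1) (\<gamma> s2) \<subseteq> M"
      using locally_segments_in_open[OF M(1) cont inM t] by blast
    then show ?thesis using le ge by (intro exI[of _ \<epsilon>]) (auto intro!: antisym)
  qed
  from affine_if_locally_additive[OF \<tau>(1) this] show ?thesis using that by metis
qed

text \<open>The line \<open>p + s U\<close> is an orthogonal one meeting the ray at time \<open>t\<close>. Cutting the corner between
  times \<open>t - \<epsilon>\<close> and \<open>t + \<epsilon>\<close> cannot save time, so \<open>F (\<epsilon> U + \<epsilon> V)\<close> is at least \<open>2 \<epsilon>\<close>, the sum of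
  \<open>F (\<epsilon> U)\<close> and \<open>F (\<epsilon> V)\<close>; hence \<open>U = V\<close>.\<close>

lemma wave_ray_orthogonal:
  assumes M: "open M" "A \<subseteq> M" and adm: "admissible_time F M A r"
    and \<tau>: "0 < \<tau>" "\<tau> \<le> r" and ray: "wave_ray F M A \<tau> \<gamma>"
    and V: "F V = 1" and aff: "\<And>t. t \<in> {0..\<tau>} \<Longrightarrow> \<gamma> t = \<gamma> 0 + t *\<^sub>R V"
  shows "F_orthogonal F A (\<gamma> 0) V"
proof -
  define t where "t = \<tau> / 2"
  have t: "0 < t" "t < \<tau>" "t \<in> {0..\<tau>}" "t \<le> r" using \<tau> by (auto simp: t_def)
  have inM: "\<gamma> ` {0..\<tau>} \<subseteq> M"
    and dist: "\<And>t. t \<in> {0..\<tau>} \<Longrightarrow> F_setdist F M A (\<gamma> t) = ereal t"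
    using ray by (auto simp: wave_ray_def)
  have "\<gamma> t \<in> M" using inM t by auto
  obtain p U where p: "p \<in> A" and U: "F U = 1" "F_orthogonal F A p U" and reach: "\<gamma> t = p + t *\<^sub>R U"
    by (rule admissible_reach[OF M(1) adm \<open>\<gamma> t \<in> M\<close> t(1,4) dist[OF t(3)]])
  obtain e where e: "e > 0" "ball (\<gamma> t) e \<subseteq> M"
    using M(1) \<open>\<gamma> t \<in> M\<close> by (metis open_contains_ball)
  \<comment> \<open>\<open>\<epsilon>\<close> is so small that the shortcut stays in a ball inside \<open>M\<close> and \<open>t \<plusminus> \<epsilon>\<close> in \<open>{0..\<tau>}\<close>.\<close>
  define N where "N = norm U + norm V + 1"
  define \<epsilon> where "\<epsilon> = min t (e / N)"
  have N: "N > 0" "norm U < N" "norm V < N"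
    unfolding N_def using norm_ge_zero[of U] norm_ge_zero[of V] by linarith+
  have \<epsilon>: "0 < \<epsilon>" "\<epsilon> \<le> t" "\<epsilon> * N \<le> e"
    using t e(1) N(1) by (auto simp: \<epsilon>_def min_def field_simps)
  have small: "\<epsilon> * norm U < e" "\<epsilon> * norm V < e"
    using \<epsilon> N by (auto intro: less_le_trans[OF mult_strict_left_mono])
  have t\<epsilon>: "t + \<epsilon> \<in> {0..\<tau>}" "t - \<epsilon> \<in> {0..r}" using \<epsilon> t by (auto simp: t_def)
  have x: "p + (t - \<epsilon>) *\<^sub>R U = \<gamma> t - \<epsilon> *\<^sub>R U" unfolding reach by (simp add: algebra_simps)
  have y: "\<gamma> (t + \<epsilon>) = \<gamma> t + \<epsilon> *\<^sub>R V"
    unfolding aff[OF t\<epsilon>(1)] aff[OF t(3)] by (simp add: algebra_simps)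
  have "\<gamma> t - \<epsilon> *\<^sub>R U \<in> ball (\<gamma> t) e" "\<gamma> t + \<epsilon> *\<^sub>R V \<in> ball (\<gamma> t) e"
    using small \<epsilon>(1) by (auto simp: dist_norm)
  then have seg: "closed_segment (p + (t - \<epsilon>) *\<^sub>R U) (\<gamma> (t + \<epsilon>)) \<subseteq> M"
    unfolding x y using e(2) closed_segment_subset[OF _ _ convex_ball] by blast
  have diff: "\<gamma> (t + \<epsilon>) - (p + (t - \<epsilon>) *\<^sub>R U) = \<epsilon> *\<^sub>R U + \<epsilon> *\<^sub>R V" unfolding x y by simp
  have "t + \<epsilon> \<le> (t - \<epsilon>) + F (\<epsilon> *\<^sub>R U + \<epsilon> *\<^sub>R V)"
    using F_setdist_orthogonal_then_segment[OF M adm p U t\<epsilon>(2) seg] dist[OF t\<epsilon>(1)]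
    unfolding diff by simp
  then have "F (\<epsilon> *\<^sub>R U) + F (\<epsilon> *\<^sub>R V) \<le> F (\<epsilon> *\<^sub>R U + \<epsilon> *\<^sub>R V)"
    using \<epsilon>(1) U(1) V by (simp add: F_scale)
  moreover have "\<epsilon> *\<^sub>R U \<noteq> 0" using \<epsilon>(1) U(1) by auto
  ultimately have "\<epsilon> *\<^sub>R V = (F (\<epsilon> *\<^sub>R V) / F (\<epsilon> *\<^sub>R U)) *\<^sub>R (\<epsilon> *\<^sub>R U)"
    by (rule F_triangle_eqD)
  then have "V = U" using \<epsilon>(1) U(1) V by (simp add: F_scale)
  then have "p = \<gamma> 0" using reach aff[OF t(3)] by simp
  then show ?thesis using U(2) \<open>V = U\<close> by simp
qed

theorem wave_ray_iff:
  assumes M: "open M" "A \<subseteq> M" and adm: "admissible_time F M A r"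
    and \<tau>: "0 < \<tau>" "\<tau> \<le> r" and p: "p \<in> A"
  shows "wave_ray F M A \<tau> \<gamma> \<and> \<gamma> 0 = p \<longleftrightarrow>
    (\<exists>V. F V = 1 \<and> F_orthogonal F A p V \<and> (\<forall>t\<in>{0..\<tau>}. \<gamma> t = p + t *\<^sub>R V))"
proof
  assume ray: "wave_ray F M A \<tau> \<gamma> \<and> \<gamma> 0 = p"
  then obtain V where V: "F V = 1" "\<And>t. t \<in> {0..\<tau>} \<Longrightarrow> \<gamma> t = \<gamma> 0 + t *\<^sub>R V"
    using wave_ray_affine[OF M adm \<tau>, of \<gamma>] by metis
  then have aff: "\<forall>t\<in>{0..\<tau>}. \<gamma> t = p + t *\<^sub>R V" using ray by auto
  then show "\<exists>V. F V = 1 \<and> F_orthogonal F A p V \<and> (\<forall>t\<in>{0..\<tau>}. \<gamma> t = p + t *\<^sub>R V)"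
    using wave_ray_orthogonal[OF M adm \<tau> _ V] ray V(1) by (intro exI[of _ V]) simp
next
  assume "\<exists>V. F V = 1 \<and> F_orthogonal F A p V \<and> (\<forall>t\<in>{0..\<tau>}. \<gamma> t = p + t *\<^sub>R V)"
  then obtain V where V: "F V = 1" "F_orthogonal F A p V"
    and aff: "\<And>t. t \<in> {0..\<tau>} \<Longrightarrow> \<gamma> t = p + t *\<^sub>R V" by blast
  have "\<gamma> 0 = p" using aff[of 0] \<tau> by simp
  moreover have "\<gamma> t \<in> M" "F_setdist F M A (\<gamma> t) = ereal t" if "t \<in> {0..\<tau>}" for t
    using admissible_line[OF M adm p V, of t] aff[OF that] that \<tau> by auto
  ultimately show "wave_ray F M A \<tau> \<gamma> \<and> \<gamma> 0 = p"
    unfolding wave_ray_def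
    using affine_imp_piecewise_smooth_curve[OF aff] unit_speed_affine[OF aff \<tau>(1) V(1)] p by auto
qed

end

section \<open>Randers metrics of constant Zermelo data\<close>

lemma deriv_quadratic: "deriv (\<lambda>s::real. c0 + c1 * s + c2 * s\<^sup>2) 0 = c1"
  by (rule DERIV_imp_deriv) (auto intro!: derivative_eq_intros)

locale constant_zermelo_data =
  fixes h :: "'a::euclidean_space \<Rightarrow> 'a \<Rightarrow> real" and W :: 'a
  assumes h_bilinear: "bilinear h"
    and h_sym: "h X Y = h Y X"
    and h_pos: "X \<noteq> 0 \<Longrightarrow> 0 < h X X"
    and mild_wind: "h W W < 1"
begin

lemmas h_simps = bilinear_ladd[OF h_bilinear] bilinear_radd[OF h_bilinear]
  bilinear_lsub[OF h_bilinear] bilinear_rsub[OF h_bilinear]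
  bilinear_lmul[OF h_bilinear] bilinear_rmul[OF h_bilinear]
  bilinear_lzero[OF h_bilinear] bilinear_rzero[OF h_bilinear]

abbreviation F where "F \<equiv> zermelo_randers h W"
abbreviation (input) lam where "lam \<equiv> 1 - h W W"
abbreviation (input) disc where "disc V \<equiv> (h W V)\<^sup>2 + (1 - h W W) * h V V"

lemma h_nonneg: "0 \<le> h X X"
  using h_pos[of X] by (cases "X = 0") (auto simp: h_simps)

lemma F_eq: "F V = (sqrt (disc V) - h W V) / lam"
  by (simp add: zermelo_randers_def Let_def)

lemma disc_pos: "V \<noteq> 0 \<Longrightarrow> 0 < disc V"
  using h_pos[of V] mild_wind by (intro add_nonneg_pos mult_pos_pos) auto

lemma zermelo_pos:
  assumes "V \<noteq> 0"
  shows "0 < F V"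
proof -
  have "(h W V)\<^sup>2 < disc V" using h_pos[OF assms] mild_wind by simp
  then have "\<bar>h W V\<bar> < sqrt (disc V)" using real_less_rsqrt[of "\<bar>h W V\<bar>"] by simp
  then show ?thesis unfolding F_eq using mild_wind by simp
qed

lemma zermelo_scale:
  assumes "0 \<le> c"
  shows "F (c *\<^sub>R V) = c * F V"
proof -
  have "disc (c *\<^sub>R V) = c\<^sup>2 * disc V"
    by (simp add: h_simps power2_eq_square algebra_simps)
  then have "sqrt (disc (c *\<^sub>R V)) = c * sqrt (disc V)" using assms by (simp add: real_sqrt_mult)
  then show ?thesis unfolding F_eq by (simp add: h_simps field_simps)
qed

lemma zermelo_continuous: "continuous_on UNIV F"
proof -
  have bb: "bounded_bilinear h" using h_bilinear by (simp add: bilinear_conv_bounded_bilinear)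
  have c: "continuous_on UNIV (\<lambda>V. h W V)" "continuous_on UNIV (\<lambda>V. h V V)"
    by (intro bounded_bilinear.continuous_on[OF bb] continuous_intros)+
  have "continuous_on UNIV (\<lambda>V. (sqrt (disc V) - h W V) / lam)"
    using mild_wind by (intro continuous_intros c) auto
  then show ?thesis by (simp add: F_eq[abs_def])
qed

lemma h_unit_le: "h N N = 1 \<Longrightarrow> h X X = 1 \<Longrightarrow> h N X \<le> 1"
  using h_nonneg[of "N - X"] h_sym[of X N] by (simp add: h_simps)

lemma h_unit_eqD: "h N N = 1 \<Longrightarrow> h X X = 1 \<Longrightarrow> h N X = 1 \<Longrightarrow> X = N"
  using h_pos[of "N - X"] h_sym[of X N] by (cases "N = X") (auto simp: h_simps)

lemma h_unit_wind: "h N N = 1 \<Longrightarrow> -1 < h N W"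
  using h_nonneg[of "W + N"] h_sym[of N W] mild_wind by (simp add: h_simps)

text \<open>By its formula, \<open>F V\<close> is the larger root \<open>x\<close> of \<open>(1 - h W W) x\<^sup>2 + 2 h W V x = h V V\<close>, that is, of
  \<open>h (V - x W) (V - x W) = x\<^sup>2\<close>. If \<open>x = 1\<close> solves this, it is the larger root: the wind is weaker than
  \<open>1\<close>, which makes \<open>1 - h W W + h W V\<close> positive on the translated sphere.\<close>

lemma indicatrix: "F V = 1 \<longleftrightarrow> h (V - W) (V - W) = 1"
proof
  assume "F V = 1"
  then have "sqrt (disc V) = lam + h W V" using mild_wind unfolding F_eq by (simp add: field_simps)
  moreover have "0 \<le> disc V" using h_nonneg[of V] mild_wind by simp
  ultimately have "disc V = (lam + h W V)\<^sup>2" by (metis real_sqrt_pow2)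
  then have "lam * h V V = lam * (lam + 2 * h W V)" by (simp add: power2_eq_square algebra_simps)
  then have "h V V = lam + 2 * h W V" using mild_wind by simp
  then show "h (V - W) (V - W) = 1" using h_sym[of V W] by (simp add: h_simps)
next
  assume N: "h (V - W) (V - W) = 1"
  then have hVV: "h V V = lam + 2 * h W V" using h_sym[of V W] by (simp add: h_simps)
  have "disc V = (lam + h W V)\<^sup>2" unfolding hVV by (simp add: power2_eq_square algebra_simps)
  moreover have "0 \<le> lam + h W V"
    using h_unit_wind[OF N] h_sym[of V W] by (simp add: h_simps)
  ultimately have "sqrt (disc V) = lam + h W V" by simp
  then show "F V = 1" unfolding F_eq using mild_wind by simp
qed

lemma sqrt_disc_indicatrix:
  assumes "F V = 1"
  shows "sqrt (disc V) = h (V - W) V" "0 < h (V - W) V"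
proof -
  have N: "h (V - W) (V - W) = 1" using assms by (simp add: indicatrix)
  have "h (V - W) V = 1 + h (V - W) W" using N by (simp add: h_simps)
  then show "0 < h (V - W) V" using h_unit_wind[OF N] by simp
  have "sqrt (disc V) = lam + h W V"
    using assms mild_wind unfolding F_eq by (simp add: field_simps)
  then show "sqrt (disc V) = h (V - W) V" using N h_sym[of V W] by (simp add: h_simps)
qed

text \<open>With \<open>N = V - W\<close>, the form \<open>h N\<close> attains its maximum over the translated sphere at \<open>V\<close> only, since
  on the untranslated unit sphere it does so at \<open>N\<close> only; the translation only adds the
  constant \<open>h N W\<close>. As this constant exceeds \<open>-1\<close>, the maximum \<open>h N V\<close> is positive, and dividing by it
  gives the support functional.\<close>

lemma zermelo_support:
  assumes "F V = 1"
  shows "\<exists>l. linear l \<and> l V = 1 \<and> (\<forall>U. l U \<le> F U) \<and> (\<forall>U. l U = F U \<longrightarrow> U = F U *\<^sub>R V)"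
proof -
  define N where "N = V - W"
  have N: "h N N = 1" using assms by (simp add: indicatrix N_def)
  have NV: "h N V = 1 + h N W" "0 < h N V"
    using N sqrt_disc_indicatrix(2)[OF assms] by (simp_all add: N_def h_simps)
  define l where "l U = h N U / h N V" for U
  have lin: "linear l"
    unfolding l_def by (rule linearI) (simp_all add: h_simps add_divide_distrib)
  have F0: "F 0 = 0" using zermelo_scale[of 0 0] by simp
  have unit: "l Y \<le> 1 \<and> (l Y = 1 \<longrightarrow> Y = V)" if "F Y = 1" for Y
  proof -
    have Y: "h (Y - W) (Y - W) = 1" using that by (simp add: indicatrix)
    have split: "h N Y = h N (Y - W) + h N W" by (simp add: h_simps)
    have "h N Y \<le> h N V" using split NV h_unit_le[OF N Y] by simp
    moreover have "Y = V" if "h N Y = h N V"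
      using h_unit_eqD[OF N Y] split NV that unfolding N_def by simp
    ultimately show ?thesis using NV(2) by (auto simp: l_def field_simps)
  qed
  have "l U \<le> F U \<and> (l U = F U \<longrightarrow> U = F U *\<^sub>R V)" for U
  proof (cases "U = 0")
    case True
    then show ?thesis using F0 linear_0[OF lin] by simp
  next
    case False
    define Y where "Y = (1 / F U) *\<^sub>R U"
    have FU: "0 < F U" using zermelo_pos[OF False] .
    have "F Y = 1" "U = F U *\<^sub>R Y" using FU by (simp_all add: Y_def zermelo_scale)
    moreover have "l U = F U * l Y" using FU by (simp add: Y_def linear_scale[OF lin])
    ultimately show ?thesis using unit[of Y] FU by auto
  qed
  then show ?thesis using lin NV(2) by (intro exI[of _ l]) (auto simp: l_def)
qed

sublocale strictly_convex_gauge F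
  using zermelo_pos zermelo_scale zermelo_continuous zermelo_support
  by unfold_locales auto

lemma deriv_zermelo_square:
  assumes "V \<noteq> 0"
  shows "deriv (\<lambda>s. (F (V + s *\<^sub>R U))\<^sup>2) 0 =
    2 * F V * ((((h W V) * h W U + lam * h V U) / sqrt (disc V) - h W U) / lam)"
proof -
  define D where "D = (h W V * h W U + lam * h V U) / sqrt (disc V)"
  have disc_line: "disc (V + s *\<^sub>R U) = (h W V + s * h W U)\<^sup>2
      + lam * (h V V + 2 * s * h V U + s\<^sup>2 * h U U)" for s
    using h_sym[of U V] by (simp add: h_simps power2_eq_square algebra_simps)
  have disc_deriv: "((\<lambda>s. disc (V + s *\<^sub>R U)) has_real_derivative 2 * (h W V * h W U + lam * h V U)) (at 0)"
    unfolding disc_line by (auto intro!: derivative_eq_intros simp: algebra_simps)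
  have "(sqrt has_real_derivative inverse (sqrt (disc V)) / 2) (at (disc (V + 0 *\<^sub>R U)))"
    using DERIV_real_sqrt[OF disc_pos[OF assms]] by simp
  from DERIV_chain2[where f = sqrt and g = "\<lambda>s. disc (V + s *\<^sub>R U)" and x = 0, OF this disc_deriv]
  have sqrt_deriv: "((\<lambda>s. sqrt (disc (V + s *\<^sub>R U))) has_real_derivative D) (at 0)"
    by (rule DERIV_cong) (simp add: D_def inverse_eq_divide add_divide_distrib)
  have wind_line: "h W (V + s *\<^sub>R U) = h W V + s * h W U" for s by (simp add: h_simps)
  have "((\<lambda>s. h W (V + s *\<^sub>R U)) has_real_derivative h W U) (at 0)"
    unfolding wind_line by (auto intro!: derivative_eq_intros)
  from DERIV_cdivide[OF DERIV_diff[OF sqrt_deriv this], of lam]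
  have "((\<lambda>s. F (V + s *\<^sub>R U)) has_real_derivative (D - h W U) / lam) (at 0)"
    unfolding F_eq .
  from DERIV_power[OF this, of 2]
  have "((\<lambda>s. (F (V + s *\<^sub>R U))\<^sup>2) has_real_derivative 2 * F V * ((D - h W U) / lam)) (at 0)"
    by (rule DERIV_cong) simp
  then show ?thesis unfolding D_def by (rule DERIV_imp_deriv)
qed

text \<open>Since \<open>F\<^sup>2\<close> is 2-homogeneous, its derivative in direction \<open>U\<close> at \<open>(1 + t) V\<close> is \<open>1 + t\<close> times that at
  \<open>V\<close>, so the mixed second derivative is again the first derivative at \<open>V\<close>.\<close>

lemma fundamental_tensor_zermelo:
  assumes "F V = 1"
  shows "fundamental_tensor F V V U = h (V - W) U / h (V - W) V"
proof -
  have V: "V \<noteq> 0" using assms by auto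
  define G where "G = (((h W V) * h W U + lam * h V U) / sqrt (disc V) - h W U) / lam"
  have inner: "deriv (\<lambda>s. (F (V + t *\<^sub>R V + s *\<^sub>R U))\<^sup>2) 0 = 2 * (1 + t) * G" if t: "-1 < t" for t
  proof -
    define c where "c = 1 + t"
    have c: "c > 0" "V + t *\<^sub>R V = c *\<^sub>R V" using t by (auto simp: c_def algebra_simps)
    have "disc (c *\<^sub>R V) = c\<^sup>2 * disc V"
      by (simp add: h_simps power2_eq_square algebra_simps)
    then have sq: "sqrt (disc (c *\<^sub>R V)) = c * sqrt (disc V)" using c by (simp add: real_sqrt_mult)
    have "h W (c *\<^sub>R V) * h W U + lam * h (c *\<^sub>R V) U = c * (h W V * h W U + lam * h V U)"
      by (simp add: h_simps algebra_simps)
    then have "(h W (c *\<^sub>R V) * h W U + lam * h (c *\<^sub>R V) U) / sqrt (disc (c *\<^sub>R V))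
        = (h W V * h W U + lam * h V U) / sqrt (disc V)"
      unfolding sq using c(1) by simp
    then show ?thesis
      using deriv_zermelo_square[of "c *\<^sub>R V" U] c V assms
      by (simp add: G_def zermelo_scale c_def)
  qed
  have "hessian (\<lambda>Z. (F Z)\<^sup>2) V V U = deriv (\<lambda>t. 2 * (1 + t) * G) 0"
    unfolding hessian_def
  proof (rule deriv_cong_ev)
    have "eventually (\<lambda>t::real. t \<in> {-1<..}) (nhds 0)" by (rule eventually_nhds_in_open) auto
    then show "eventually (\<lambda>t. deriv (\<lambda>s. (F (V + t *\<^sub>R V + s *\<^sub>R U))\<^sup>2) 0 = 2 * (1 + t) * G) (nhds 0)"
      by eventually_elim (use inner in auto)
  qed simp
  also have "\<dots> = 2 * G"
    by (rule DERIV_imp_deriv) (auto intro!: derivative_eq_intros)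
  finally have "fundamental_tensor F V V U = G" by (simp add: fundamental_tensor_def)
  also have "G = h (V - W) U / h (V - W) V"
  proof -
    define R where "R = h (V - W) V"
    have R: "sqrt (disc V) = R" "R > 0" using sqrt_disc_indicatrix[OF assms] by (simp_all add: R_def)
    have R_eq: "R = lam + h W V"
      using assms mild_wind R(1) unfolding F_eq by (simp add: field_simps)
    have "h W V * h W U + lam * h V U - R * h W U = lam * (h V U - h W U)"
      unfolding R_eq by (simp add: algebra_simps)
    then have "(h W V * h W U + lam * h V U) / R - h W U = lam * (h V U - h W U) / R"
      using R(2) by (simp add: field_simps)
    then show ?thesis
      unfolding G_def R(1) R_def[symmetric] using mild_wind by (simp add: h_simps)
  qed
  finally show ?thesis .
qed

lemma F_orthogonal_iff: "F V = 1 \<Longrightarrow> F_orthogonal F A p V \<longleftrightarrow> h_orthogonal h A p (V - W)"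
  using sqrt_disc_indicatrix(2)[of V]
  by (auto simp: F_orthogonal_def h_orthogonal_def fundamental_tensor_zermelo)

lemma unit_orthogonal_iff: "F V = 1 \<and> F_orthogonal F A p V \<longleftrightarrow>
    metric_norm h (V - W) = 1 \<and> h_orthogonal h A p (V - W)"
  using F_orthogonal_iff[of V A p] indicatrix[of V] by (auto simp: metric_norm_def)

end

lemma tangent_space_singleton:
  assumes "U \<in> tangent_space_at {p} p"
  shows "U = 0"
proof -
  obtain \<epsilon> c where e: "\<epsilon> > 0" and c: "c ` {-\<epsilon><..<\<epsilon>} \<subseteq> {p}" "(c has_vector_derivative U) (at 0)"
    using assms unfolding tangent_space_at_def by blast
  have "(c has_vector_derivative 0) (at 0)"
    by (rule has_vector_derivative_transform_within_open[of "\<lambda>_. p" _ _ "{-\<epsilon><..<\<epsilon>}"]) (use c(1) e in \<open>auto simp: image_subset_iff\<close>)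
  then show ?thesis using c(2) vector_derivative_unique_at by blast
qed

section \<open>The ellipsoidal metric\<close>

text \<open>The polarisation of the quadratic form \<open>Q_ell\<close>.\<close>

definition ell_form :: "real \<Rightarrow> real \<Rightarrow> real \<Rightarrow> real \<Rightarrow> real^3 \<Rightarrow> real^3 \<Rightarrow> real" where
  "ell_form a b c \<alpha> X Y = (X $ 1 / a) * (Y $ 1 / a)
     + ((X $ 2 * cos \<alpha> - X $ 3 * sin \<alpha>) / b) * ((Y $ 2 * cos \<alpha> - Y $ 3 * sin \<alpha>) / b)
     + ((X $ 2 * sin \<alpha> + X $ 3 * cos \<alpha>) / c) * ((Y $ 2 * sin \<alpha> + Y $ 3 * cos \<alpha>) / c)"

lemma Q_ell_eq: "Q_ell a b c \<alpha> X = ell_form a b c \<alpha> X X"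
  by (simp add: Q_ell_def ell_form_def power2_eq_square)

lemma ell_form_sym: "ell_form a b c \<alpha> X Y = ell_form a b c \<alpha> Y X"
  by (simp add: ell_form_def mult.commute)

lemma bilinear_ell_form: "bilinear (ell_form a b c \<alpha>)"
  unfolding bilinear_def
  by (auto intro!: linearI simp: ell_form_def add_divide_distrib diff_divide_distrib algebra_simps)

lemma ell_form_pos:
  assumes "a > 0" "b > 0" "c > 0" "X \<noteq> 0"
  shows "0 < ell_form a b c \<alpha> X X"
proof -
  have nn: "0 \<le> ell_form a b c \<alpha> X X" unfolding ell_form_def by (intro add_nonneg_nonneg) auto
  have "X = 0" if "ell_form a b c \<alpha> X X = 0"
  proof -
    define u v where "u = X $ 2 * cos \<alpha> - X $ 3 * sin \<alpha>" and "v = X $ 2 * sin \<alpha> + X $ 3 * cos \<alpha>"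
    have "(X $ 1 / a)\<^sup>2 + (u / b)\<^sup>2 + (v / c)\<^sup>2 = 0"
      using that unfolding ell_form_def u_def v_def by (simp add: power2_eq_square)
    then have 0: "X $ 1 = 0" "u = 0" "v = 0"
      using assms(1-3) by (auto simp: add_nonneg_eq_0_iff)
    \<comment> \<open>Undo the rotation by \<open>\<alpha>\<close>.\<close>
    have "u * cos \<alpha> + v * sin \<alpha> = X $ 2 * ((sin \<alpha>)\<^sup>2 + (cos \<alpha>)\<^sup>2)"
         "v * cos \<alpha> - u * sin \<alpha> = X $ 3 * ((sin \<alpha>)\<^sup>2 + (cos \<alpha>)\<^sup>2)"
      unfolding u_def v_def by (simp_all only: power2_eq_square algebra_simps)
    then show "X = 0" using 0 by (simp add: vec_eq_iff forall_3)
  qed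
  then show ?thesis using nn assms(4) by fastforce
qed

lemma ell_metric_eq: "ell_metric a b c \<alpha> = ell_form a b c \<alpha>"
proof (intro ext)
  fix X Y
  let ?B = "ell_form a b c \<alpha>"
  have "Q_ell a b c \<alpha> (0 + t *\<^sub>R X + s *\<^sub>R Y) = t\<^sup>2 * ?B X X + (2 * t * ?B X Y) * s + ?B Y Y * s\<^sup>2" for s t
    using ell_form_sym[of a b c \<alpha> Y X]
    by (simp add: Q_ell_eq bilinear_ladd[OF bilinear_ell_form] bilinear_radd[OF bilinear_ell_form]
        bilinear_lmul[OF bilinear_ell_form] bilinear_rmul[OF bilinear_ell_form]
        power2_eq_square algebra_simps)
  then have "hessian (Q_ell a b c \<alpha>) 0 X Y = deriv (\<lambda>t. 2 * t * ?B X Y) 0"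
    unfolding hessian_def by (simp add: deriv_quadratic)
  also have "\<dots> = 2 * ?B X Y"
    by (rule DERIV_imp_deriv) (auto intro!: derivative_eq_intros)
  finally show "ell_metric a b c \<alpha> X Y = ?B X Y" by (simp add: ell_metric_def)
qed

theorem theorem3p2:
  fixes M A :: "(real^3) set" and W :: "real^3" and W2 W3 a b c \<alpha> r :: real
    and Q :: "real^3 \<Rightarrow> real" and h :: "real^3 \<Rightarrow> real^3 \<Rightarrow> real" and F :: "real^3 \<Rightarrow> real"
    and k :: nat
  assumes "open M"
    and "a > 0" "b > 0" "c > 0"
    and "Q = Q_ell a b c \<alpha>"
    and "h = ell_metric a b c \<alpha>"
    and "W = vector [0, W2, W3]"
    and "h W W < 1"
    and "F = zermelo_randers h W"
    and "compact A" "A \<subseteq> M" "smooth_submanifold k A"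
    and "admissible_time F M A r"
  shows
    "(\<forall>p\<in>M. \<forall>rp \<tau>. admissible_time F M {p} rp \<and> 0 < \<tau> \<and> \<tau> \<le> rp \<longrightarrow>
        spherical_wavefront F M p \<tau> = {x + \<tau> *\<^sub>R W + p | x. Q ((1 / \<tau>) *\<^sub>R x) = 1})
     \<and>
     (\<forall>p\<in>A. \<forall>\<tau> \<gamma>. 0 < \<tau> \<and> \<tau> \<le> r \<longrightarrow>
        (wave_ray F M A \<tau> \<gamma> \<and> \<gamma> 0 = p \<longleftrightarrow>
         (\<exists>V. metric_norm h (V - W) = 1 \<and> h_orthogonal h A p (V - W) \<and>
              (\<forall>t\<in>{0..\<tau>}. \<gamma> t = p + t *\<^sub>R V))))
     \<and>
     (\<forall>\<tau>. 0 < \<tau> \<and> \<tau> \<le> r \<longrightarrow>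
        wavefront F M A \<tau> =
          {p + \<tau> *\<^sub>R V | p V. p \<in> A \<and> metric_norm h (V - W) = 1 \<and> h_orthogonal h A p (V - W)})"
proof -
  have h: "h = ell_form a b c \<alpha>" using assms by (simp add: ell_metric_eq)
  interpret constant_zermelo_data h W
    by unfold_locales
       (use assms(2-4,8) h bilinear_ell_form ell_form_sym ell_form_pos in auto)
  have F: "F = zermelo_randers h W" by fact
  note unit_iff = unit_orthogonal_iff[folded F]
  have spherical: "spherical_wavefront F M p \<tau> = {x + \<tau> *\<^sub>R W + p | x. Q ((1 / \<tau>) *\<^sub>R x) = 1}"
    if "p \<in> M" "admissible_time F M {p} rp" "0 < \<tau>" "\<tau> \<le> rp" for p rp \<tau>
  proof -
    have all_orth: "h_orthogonal h {p} p X" for X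
      by (auto simp: h_orthogonal_def h_simps dest!: tangent_space_singleton)
    have Q: "metric_norm h X = 1 \<longleftrightarrow> Q X = 1" for X
      using assms(5) h by (simp add: metric_norm_def Q_ell_eq)
    have "wavefront F M {p} \<tau> = {p + \<tau> *\<^sub>R V | V. Q (V - W) = 1}"
      unfolding F using wavefront_eq[of M "{p}" rp \<tau>] that assms(1) all_orth
      by (simp add: F unit_orthogonal_iff Q)
    also have "\<dots> = {x + \<tau> *\<^sub>R W + p | x. Q ((1 / \<tau>) *\<^sub>R x) = 1}" (is "?L = ?R")
    proof (intro set_eqI iffI)
      fix q assume "q \<in> ?L"
      then obtain V where V: "q = p + \<tau> *\<^sub>R V" "Q (V - W) = 1" by blast
      have "q = \<tau> *\<^sub>R (V - W) + \<tau> *\<^sub>R W + p" by (simp add: V(1) algebra_simps)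
      moreover have "Q ((1 / \<tau>) *\<^sub>R (\<tau> *\<^sub>R (V - W))) = 1" using V(2) \<open>0 < \<tau>\<close> by simp
      ultimately show "q \<in> ?R" by blast
    next
      fix q assume "q \<in> ?R"
      then obtain x where x: "q = x + \<tau> *\<^sub>R W + p" "Q ((1 / \<tau>) *\<^sub>R x) = 1" by blast
      have "q = p + \<tau> *\<^sub>R ((1 / \<tau>) *\<^sub>R x + W)" using \<open>0 < \<tau>\<close> by (simp add: x(1) algebra_simps)
      moreover have "Q (((1 / \<tau>) *\<^sub>R x + W) - W) = 1" using x(2) by simp
      ultimately show "q \<in> ?L" by blast
    qed
    finally show ?thesis by (simp add: spherical_wavefront_def)
  qed
  have rays: "wave_ray F M A \<tau> \<gamma> \<and> \<gamma> 0 = p \<longleftrightarrow>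
      (\<exists>V. metric_norm h (V - W) = 1 \<and> h_orthogonal h A p (V - W) \<and>
        (\<forall>t\<in>{0..\<tau>}. \<gamma> t = p + t *\<^sub>R V))"
    if "p \<in> A" "0 < \<tau>" "\<tau> \<le> r" for p \<tau> \<gamma>
    using wave_ray_iff[of M A r \<tau> p \<gamma>] that assms(1,11,13) unit_iff[of _ A p]
    unfolding F by metis
  have fronts: "wavefront F M A \<tau> =
      {p + \<tau> *\<^sub>R V | p V. p \<in> A \<and> metric_norm h (V - W) = 1 \<and> h_orthogonal h A p (V - W)}"
    if "0 < \<tau>" "\<tau> \<le> r" for \<tau>
    using wavefront_eq[of M A r \<tau>] that assms(1,11,13) unfolding F
    by (simp add: unit_orthogonal_iff)
  show ?thesis
    by (intro conjI ballI allI impI; (elim conjE)?) (erule (3) spherical rays fronts | erule (2) rays | erule (1) fronts)+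
qed

end
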